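(* Let $H=-i\frac{d}{dx}:H^1(\mathbb R)\subset L^2(\mathbb R)\to L^2(\mathbb R)$, a self-adjoint operator. For $\sigma>\frac12$, $$\lim_{T\to\infty}\frac1{2T}\int_{-T}^Te^{itH}\,dt=0$$ in the uniform operator topology on $\mathcal B(L^{2,\sigma}(\mathbb R),L^{2,-\sigma}(\mathbb R))$.
   Context: For $\sigma\in\mathbb R$, $L^{2,\sigma}(\mathbb R)$ is the space of functions $f:\mathbb R\to\mathbb C$ with $\|f\|^2_{L^{2,\sigma}(\mathbb R)}:=\int_{\mathbb R}(1+x^2)^\sigma|f(x)|^2\,dx<\infty$. $\mathcal B(X,Y)$ denotes the bounded linear operators from $X$ to $Y$ with the operator norm. For $\sigma>0$ one has $L^{2,\sigma}(\mathbb R)\subset L^2(\mathbb R)\subset L^{2,-\sigma}(\mathbb R)$, and the averages, which are operators on $L^2(\mathbb R)$, are viewed as operators from $L^{2,\sigma}(\mathbb R)$ to $L^{2,-\sigma}(\mathbb R)$ through these inclusions. *)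

theory Defs
  imports "HOL-Analysis.Analysis"
begin

section \<open>Complex Hilbert spaces\<close>

class complex_vector = real_vector +
  fixes scaleC :: "complex \<Rightarrow> 'a \<Rightarrow> 'a"  (infixr "*\<^sub>C" 75)
  assumes scaleC_add_right: "a *\<^sub>C (x + y) = a *\<^sub>C x + a *\<^sub>C y"
    and scaleC_add_left: "(a + b) *\<^sub>C x = a *\<^sub>C x + b *\<^sub>C x"
    and scaleC_scaleC: "a *\<^sub>C b *\<^sub>C x = (a * b) *\<^sub>C x"
    and scaleR_scaleC: "r *\<^sub>R x = complex_of_real r *\<^sub>C x"

text \<open>The inner product is linear in its first argument.\<close>

class complex_hilbert_space = complex_vector + real_inner + complete_space +
  fixes cinner :: "'a \<Rightarrow> 'a \<Rightarrow> complex"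
  assumes cinner_commute: "cinner x y = cnj (cinner y x)"
    and cinner_add_left: "cinner (x + y) z = cinner x z + cinner y z"
    and cinner_scaleC_left: "cinner (c *\<^sub>C x) y = c * cinner x y"
    and inner_eq_Re_cinner: "inner x y = Re (cinner x y)"
begin

subclass banach ..

end

definition csubspace :: "'a::complex_vector set \<Rightarrow> bool" where
  "csubspace S \<longleftrightarrow> 0 \<in> S \<and> (\<forall>x\<in>S. \<forall>y\<in>S. x + y \<in> S) \<and> (\<forall>c. \<forall>x\<in>S. c *\<^sub>C x \<in> S)"

definition clinear_on :: "'a::complex_vector set \<Rightarrow> ('a \<Rightarrow> 'b::complex_vector) \<Rightarrow> bool" where
  "clinear_on S A \<longleftrightarrow>
     (\<forall>x\<in>S. \<forall>y\<in>S. A (x + y) = A x + A y) \<and> (\<forall>c. \<forall>x\<in>S. A (c *\<^sub>C x) = c *\<^sub>C A x)"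

text \<open>
  An unbounded operator is given by its domain \<open>D\<close> and a function \<open>A\<close> that matters
  only on \<open>D\<close>. The last conjunct says that the graph of the adjoint is the graph of \<open>A\<close>.
\<close>

definition self_adjoint ::
    "'h::complex_hilbert_space set \<Rightarrow> ('h \<Rightarrow> 'h) \<Rightarrow> bool" where
  "self_adjoint D A \<longleftrightarrow>
     csubspace D \<and> clinear_on D A \<and> closure D = UNIV \<and>
     (\<forall>g k. (\<forall>f\<in>D. cinner (A f) g = cinner f k) \<longleftrightarrow> g \<in> D \<and> k = A g)"

definition unitary :: "('h::complex_hilbert_space \<Rightarrow> 'h) \<Rightarrow> bool" where
  "unitary U \<longleftrightarrow>
     clinear_on UNIV U \<and> surj U \<and> (\<forall>f g. cinner (U f) (U g) = cinner f g)"

definition unitary_group :: "(real \<Rightarrow> 'h::complex_hilbert_space \<Rightarrow> 'h) \<Rightarrow> bool" where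
  "unitary_group U \<longleftrightarrow>
     (\<forall>t. unitary (U t)) \<and> U 0 = id \<and> (\<forall>s t. U (s + t) = U s \<circ> U t) \<and>
     (\<forall>f. continuous_on UNIV (\<lambda>t. U t f))"

definition has_generator ::
    "(real \<Rightarrow> 'h::complex_hilbert_space \<Rightarrow> 'h) \<Rightarrow> 'h set \<Rightarrow> ('h \<Rightarrow> 'h) \<Rightarrow> bool" where
  "has_generator U D G \<longleftrightarrow>
     (\<forall>f h. ((\<lambda>t. (1 / t) *\<^sub>R (U t f - f)) \<longlongrightarrow> h) (at 0) \<longleftrightarrow> f \<in> D \<and> h = G f)"

text \<open>
  \<open>exp_i D A t\<close> is the unitary operator \<open>e\<^sup>i\<^sup>t\<^sup>A\<close>: by Stone's theorem a self-adjoint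
  \<open>A\<close> with domain \<open>D\<close> determines exactly one strongly continuous unitary group with
  infinitesimal generator \<open>\<i>A\<close>, domain included.
\<close>

definition exp_i ::
    "'h::complex_hilbert_space set \<Rightarrow> ('h \<Rightarrow> 'h) \<Rightarrow> real \<Rightarrow> 'h \<Rightarrow> 'h" where
  "exp_i D A = (THE U. unitary_group U \<and> has_generator U D (\<lambda>f. \<i> *\<^sub>C A f))"

text \<open>The operator integral is the strong one, \<open>t \<mapsto> e\<^sup>i\<^sup>t\<^sup>A f\<close> being continuous.\<close>

definition time_average ::
    "'h::complex_hilbert_space set \<Rightarrow> ('h \<Rightarrow> 'h) \<Rightarrow> real \<Rightarrow> 'h \<Rightarrow> 'h" where
  "time_average D A T f = (1 / (2 * T)) *\<^sub>R integral {-T..T} (\<lambda>t. exp_i D A t f)"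


section \<open>Measurable functions modulo null sets\<close>

definition ae_eq :: "(real \<Rightarrow> complex) \<Rightarrow> (real \<Rightarrow> complex) \<Rightarrow> bool" where
  "ae_eq f g \<longleftrightarrow>
     f \<in> borel_measurable lborel \<and> g \<in> borel_measurable lborel \<and> (AE x in lborel. f x = g x)"

lemma part_equivp_ae_eq: "part_equivp ae_eq"
proof (rule part_equivpI)
  show "\<exists>f. ae_eq f f"
    by (rule exI[of _ "\<lambda>_. 0"]) (simp add: ae_eq_def)
  show "symp ae_eq"
    by (rule sympI) (auto simp: ae_eq_def elim: AE_mp)
  show "transp ae_eq"
    by (rule transpI) (auto simp: ae_eq_def elim!: AE_mp)
qed

quotient_type L0 = "real \<Rightarrow> complex" / partial: ae_eq
  by (rule part_equivp_ae_eq)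

instantiation L0 :: complex_vector
begin

lift_definition zero_L0 :: L0 is "\<lambda>_. 0"
  by (simp add: ae_eq_def)

lift_definition plus_L0 :: "L0 \<Rightarrow> L0 \<Rightarrow> L0" is "\<lambda>f g x. f x + g x"
  by (auto simp: ae_eq_def elim!: AE_mp)

lift_definition minus_L0 :: "L0 \<Rightarrow> L0 \<Rightarrow> L0" is "\<lambda>f g x. f x - g x"
  by (auto simp: ae_eq_def elim!: AE_mp)

lift_definition uminus_L0 :: "L0 \<Rightarrow> L0" is "\<lambda>f x. - f x"
  by (auto simp: ae_eq_def elim!: AE_mp)

lift_definition scaleC_L0 :: "complex \<Rightarrow> L0 \<Rightarrow> L0" is "\<lambda>c f x. c * f x"
  by (auto simp: ae_eq_def elim!: AE_mp)

definition scaleR_L0 :: "real \<Rightarrow> L0 \<Rightarrow> L0" where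
  "scaleR_L0 r f = complex_of_real r *\<^sub>C f"

instance
proof
  fix a b :: complex and r s :: real and x y z :: L0
  show "x + y + z = x + (y + z)"
    by transfer (simp add: ae_eq_def add.assoc)
  show "x + y = y + x"
    by transfer (simp add: ae_eq_def add.commute)
  show "0 + x = x"
    by transfer (simp add: ae_eq_def)
  show "- x + x = 0"
    by transfer (simp add: ae_eq_def)
  show "x - y = x + - y"
    by transfer (simp add: ae_eq_def)
  show C1: "a *\<^sub>C (x + y) = a *\<^sub>C x + a *\<^sub>C y" for a and x y :: L0
    by transfer (simp add: ae_eq_def distrib_left)
  show C2: "(a + b) *\<^sub>C x = a *\<^sub>C x + b *\<^sub>C x" for a b and x :: L0
    by transfer (simp add: ae_eq_def distrib_right)
  show C3: "a *\<^sub>C b *\<^sub>C x = (a * b) *\<^sub>C x" for a b and x :: L0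
    by transfer (simp add: ae_eq_def mult.assoc)
  show "r *\<^sub>R x = complex_of_real r *\<^sub>C x"
    by (simp add: scaleR_L0_def)
  show "r *\<^sub>R (x + y) = r *\<^sub>R x + r *\<^sub>R y"
    by (simp add: scaleR_L0_def C1)
  show "(r + s) *\<^sub>R x = r *\<^sub>R x + s *\<^sub>R x"
    by (simp add: scaleR_L0_def C2)
  show "r *\<^sub>R s *\<^sub>R x = (r * s) *\<^sub>R x"
    by (simp add: scaleR_L0_def C3)
  have "(1::complex) *\<^sub>C x = x"
    by transfer (simp add: ae_eq_def)
  then show "1 *\<^sub>R x = x"
    by (simp add: scaleR_L0_def)
qed

end

text \<open>\<open>rep_L0 f\<close> is a chosen representative of the class \<open>f\<close>.\<close>

lemma rep_L0_measurable [measurable]: "rep_L0 f \<in> borel_measurable lborel"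
  using Quotient3_rep_reflp[OF Quotient3_L0, of f] by (simp add: ae_eq_def)

lemma abs_rep_L0: "abs_L0 (rep_L0 f) = f"
  by (rule Quotient3_abs_rep[OF Quotient3_L0])

lemma L0_eq_iff: "f = g \<longleftrightarrow> (AE x in lborel. rep_L0 f x = rep_L0 g x)"
  using Quotient3_rel_rep[OF Quotient3_L0, of f g]
  by (auto simp: ae_eq_def rep_L0_measurable[simplified])

lemma rep_abs_L0:
  assumes "f \<in> borel_measurable lborel"
  shows "AE x in lborel. rep_L0 (abs_L0 f) x = f x"
  using rep_abs_rsp_left[OF Quotient3_L0, of f f] assms by (simp add: ae_eq_def)

lemma rep_zero_L0: "AE x in lborel. rep_L0 0 x = 0"
  unfolding zero_L0_def by (rule rep_abs_L0) simp

lemma rep_plus_L0: "AE x in lborel. rep_L0 (f + g) x = rep_L0 f x + rep_L0 g x"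
  using plus_L0.abs_eq[of "rep_L0 f" "rep_L0 g"]
    rep_abs_L0[of "\<lambda>x. rep_L0 f x + rep_L0 g x"]
  by (simp add: abs_rep_L0 ae_eq_def rep_L0_measurable[simplified])

lemma rep_minus_L0: "AE x in lborel. rep_L0 (f - g) x = rep_L0 f x - rep_L0 g x"
  using minus_L0.abs_eq[of "rep_L0 f" "rep_L0 g"]
    rep_abs_L0[of "\<lambda>x. rep_L0 f x - rep_L0 g x"]
  by (simp add: abs_rep_L0 ae_eq_def rep_L0_measurable[simplified])

lemma rep_scaleC_L0: "AE x in lborel. rep_L0 (c *\<^sub>C f) x = c * rep_L0 f x"
  using scaleC_L0.abs_eq[of "rep_L0 f" c] rep_abs_L0[of "\<lambda>x. c * rep_L0 f x"]
  by (simp add: abs_rep_L0 ae_eq_def rep_L0_measurable[simplified])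


section \<open>The weighted spaces\<close>

definition L2w :: "real \<Rightarrow> L0 set" where
  "L2w s = {f. integrable lborel (\<lambda>x. (1 + x\<^sup>2) powr s * (cmod (rep_L0 f x))\<^sup>2)}"

definition wnorm :: "real \<Rightarrow> L0 \<Rightarrow> real" where
  "wnorm s f = sqrt (LINT x|lborel. (1 + x\<^sup>2) powr s * (cmod (rep_L0 f x))\<^sup>2)"

lemma L2w_mono:
  assumes "s \<le> s'"
  shows "L2w s' \<subseteq> L2w s"
proof
  fix f assume "f \<in> L2w s'"
  then have "integrable lborel (\<lambda>x. (1 + x\<^sup>2) powr s' * (cmod (rep_L0 f x))\<^sup>2)"
    by (simp add: L2w_def)
  then have "integrable lborel (\<lambda>x. (1 + x\<^sup>2) powr s * (cmod (rep_L0 f x))\<^sup>2)"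
    by (rule Bochner_Integration.integrable_bound)
       (auto intro!: AE_I2 mult_right_mono powr_mono assms simp: rep_L0_measurable[simplified])
  then show "f \<in> L2w s"
    by (simp add: L2w_def)
qed

lemma zero_in_L2w: "0 \<in> L2w s"
proof -
  have "integrable lborel (\<lambda>x. (1 + x\<^sup>2) powr s * (cmod (rep_L0 0 x))\<^sup>2) \<longleftrightarrow>
        integrable lborel (\<lambda>x::real. 0::real)"
    by (rule integrable_cong_AE) (use rep_zero_L0 in \<open>auto elim!: AE_mp\<close>)
  then show ?thesis
    by (simp add: L2w_def)
qed

lemma L2w_zero_iff: "f \<in> L2w 0 \<longleftrightarrow> integrable lborel (\<lambda>x. (cmod (rep_L0 f x))\<^sup>2)"
  unfolding L2w_def by (simp add: add_nonneg_eq_0_iff)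

lemma add_in_L2w_zero:
  assumes "f \<in> L2w 0" "g \<in> L2w 0"
  shows "f + g \<in> L2w 0"
  unfolding L2w_zero_iff
proof (rule Bochner_Integration.integrable_bound)
  show "integrable lborel (\<lambda>x. 2 * (cmod (rep_L0 f x))\<^sup>2 + 2 * (cmod (rep_L0 g x))\<^sup>2)"
    using assms by (simp add: L2w_zero_iff)
  have *: "(cmod (a + b))\<^sup>2 \<le> 2 * (cmod a)\<^sup>2 + 2 * (cmod b)\<^sup>2" for a b
  proof -
    have "(cmod (a + b))\<^sup>2 \<le> (cmod a + cmod b)\<^sup>2"
      by (simp add: norm_triangle_ineq power_mono)
    also have "\<dots> \<le> 2 * (cmod a)\<^sup>2 + 2 * (cmod b)\<^sup>2"
      using sum_squares_ge_zero[of "cmod a - cmod b" 0]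
      by (simp add: power2_eq_square algebra_simps)
    finally show ?thesis .
  qed
  show "AE x in lborel. norm ((cmod (rep_L0 (f + g) x))\<^sup>2)
      \<le> norm (2 * (cmod (rep_L0 f x))\<^sup>2 + 2 * (cmod (rep_L0 g x))\<^sup>2)"
    using rep_plus_L0[of f g] by eventually_elim (simp add: *)
qed measurable

lemma scaleC_in_L2w_zero:
  assumes "f \<in> L2w 0"
  shows "c *\<^sub>C f \<in> L2w 0"
  unfolding L2w_zero_iff
proof (rule Bochner_Integration.integrable_bound)
  show "integrable lborel (\<lambda>x. (cmod c)\<^sup>2 * (cmod (rep_L0 f x))\<^sup>2)"
    using assms by (simp add: L2w_zero_iff)
  show "AE x in lborel. norm ((cmod (rep_L0 (c *\<^sub>C f) x))\<^sup>2)
      \<le> norm ((cmod c)\<^sup>2 * (cmod (rep_L0 f x))\<^sup>2)"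
    using rep_scaleC_L0[of c f]
    by eventually_elim (simp add: norm_mult power_mult_distrib)
qed measurable

lemma uminus_L0_eq: "- f = (-1) *\<^sub>C (f :: L0)"
  by transfer (simp add: ae_eq_def)


lemma cnj_measurable [measurable (raw)]:
  assumes "f \<in> borel_measurable M"
  shows "(\<lambda>x. cnj (f x)) \<in> borel_measurable M"
  by (rule borel_measurable_continuous_on[OF _ assms]) (intro continuous_intros)


section \<open>The Hilbert space of square integrable functions\<close>

typedef L2 = "L2w 0"
  using zero_in_L2w by blast

setup_lifting type_definition_L2

abbreviation fn :: "L2 \<Rightarrow> real \<Rightarrow> complex" where
  "fn f \<equiv> rep_L0 (Rep_L2 f)"

lemma fn_measurable [measurable]: "fn f \<in> borel_measurable lborel"
  by (rule rep_L0_measurable)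

lemma fn_square_integrable: "integrable lborel (\<lambda>x. (cmod (fn f x))\<^sup>2)"
  using Rep_L2[of f] by (simp add: L2w_zero_iff)

lemma fn_product_integrable: "integrable lborel (\<lambda>x. fn f x * cnj (fn g x))"
proof (rule Bochner_Integration.integrable_bound)
  show "integrable lborel (\<lambda>x. (cmod (fn f x))\<^sup>2 + (cmod (fn g x))\<^sup>2)"
    by (simp add: fn_square_integrable)
  have *: "a * b \<le> a\<^sup>2 + b\<^sup>2" if "a \<ge> 0" "b \<ge> 0" for a b :: real
    using sum_squares_bound[of a b] mult_nonneg_nonneg[OF that] by linarith
  show "AE x in lborel. norm (fn f x * cnj (fn g x))
      \<le> norm ((cmod (fn f x))\<^sup>2 + (cmod (fn g x))\<^sup>2)"
    by (rule AE_I2) (simp add: norm_mult *)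
qed measurable

instantiation L2 :: complex_vector
begin

lift_definition zero_L2 :: L2 is 0
  by (rule zero_in_L2w)

lift_definition plus_L2 :: "L2 \<Rightarrow> L2 \<Rightarrow> L2" is "(+)"
  by (rule add_in_L2w_zero)

lift_definition uminus_L2 :: "L2 \<Rightarrow> L2" is uminus
  by (simp add: uminus_L0_eq scaleC_in_L2w_zero)

lift_definition minus_L2 :: "L2 \<Rightarrow> L2 \<Rightarrow> L2" is "(-)"
  by (metis add_in_L2w_zero scaleC_in_L2w_zero uminus_L0_eq diff_conv_add_uminus)

lift_definition scaleC_L2 :: "complex \<Rightarrow> L2 \<Rightarrow> L2" is scaleC
  by (rule scaleC_in_L2w_zero)

lift_definition scaleR_L2 :: "real \<Rightarrow> L2 \<Rightarrow> L2" is scaleR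
  by (simp add: scaleR_scaleC scaleC_in_L2w_zero)

instance
proof
  fix a b :: complex and r s :: real and x y z :: L2
  show "x + y + z = x + (y + z)"
    by transfer (rule add.assoc)
  show "x + y = y + x"
    by transfer (rule add.commute)
  show "0 + x = x"
    by transfer (rule add_0_left)
  show "- x + x = 0"
    by transfer (rule add.left_inverse)
  show "x - y = x + - y"
    by transfer (rule diff_conv_add_uminus)
  show "a *\<^sub>C (x + y) = a *\<^sub>C x + a *\<^sub>C y"
    by transfer (rule scaleC_add_right)
  show "(a + b) *\<^sub>C x = a *\<^sub>C x + b *\<^sub>C x"
    by transfer (rule scaleC_add_left)
  show "a *\<^sub>C b *\<^sub>C x = (a * b) *\<^sub>C x"
    by transfer (rule scaleC_scaleC)
  show "r *\<^sub>R x = complex_of_real r *\<^sub>C x"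
    by transfer (rule scaleR_scaleC)
  show "r *\<^sub>R (x + y) = r *\<^sub>R x + r *\<^sub>R y"
    by transfer (rule scaleR_add_right)
  show "(r + s) *\<^sub>R x = r *\<^sub>R x + s *\<^sub>R x"
    by transfer (rule scaleR_add_left)
  show "r *\<^sub>R s *\<^sub>R x = (r * s) *\<^sub>R x"
    by transfer (rule scaleR_scaleR)
  show "1 *\<^sub>R x = x"
    by transfer (rule scaleR_one)
qed

end

instantiation L2 :: real_inner
begin

definition norm_L2 :: "L2 \<Rightarrow> real" where
  "norm_L2 f = wnorm 0 (Rep_L2 f)"

definition inner_L2 :: "L2 \<Rightarrow> L2 \<Rightarrow> real" where
  "inner_L2 f g = Re (LINT x|lborel. fn f x * cnj (fn g x))"

definition dist_L2 :: "L2 \<Rightarrow> L2 \<Rightarrow> real" where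
  "dist_L2 f g = norm (f - g)"

definition sgn_L2 :: "L2 \<Rightarrow> L2" where
  "sgn_L2 f = inverse (norm f) *\<^sub>R f"

definition uniformity_L2 :: "(L2 \<times> L2) filter" where
  "uniformity_L2 = (INF e\<in>{0<..}. principal {(x, y). dist x y < e})"

definition open_L2 :: "L2 set \<Rightarrow> bool" where
  "open_L2 U \<longleftrightarrow> (\<forall>x\<in>U. \<forall>\<^sub>F (x', y) in uniformity. x' = x \<longrightarrow> y \<in> U)"

lemma norm_L2_eq: "norm (f::L2) = sqrt (LINT x|lborel. (cmod (fn f x))\<^sup>2)"
proof -
  have "(1 + x\<^sup>2) powr 0 = (1::real)" for x :: real
    by (simp add: add_nonneg_eq_0_iff)
  then show ?thesis
    by (simp add: norm_L2_def wnorm_def)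
qed

lemma fn_plus: "AE x in lborel. fn (f + g) x = fn f x + fn g x"
  by (simp add: plus_L2.rep_eq rep_plus_L0)

lemma fn_minus: "AE x in lborel. fn (f - g) x = fn f x - fn g x"
  by (simp add: minus_L2.rep_eq rep_minus_L0)

lemma fn_scaleC: "AE x in lborel. fn (c *\<^sub>C f) x = c * fn f x"
  by (simp add: scaleC_L2.rep_eq rep_scaleC_L0)

lemma L2_eq_iff: "f = g \<longleftrightarrow> (AE x in lborel. fn f x = fn g x)"
  by (simp add: L0_eq_iff[symmetric] Rep_L2_inject)

lemma pairing_add_left:
  "(LINT x|lborel. fn (f + g) x * cnj (fn h x)) =
   (LINT x|lborel. fn f x * cnj (fn h x)) + (LINT x|lborel. fn g x * cnj (fn h x))"
proof -
  have "(LINT x|lborel. fn (f + g) x * cnj (fn h x)) =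
      (LINT x|lborel. fn f x * cnj (fn h x) + fn g x * cnj (fn h x))"
  proof (rule integral_cong_AE)
    show "AE x in lborel. fn (f + g) x * cnj (fn h x)
        = fn f x * cnj (fn h x) + fn g x * cnj (fn h x)"
      using fn_plus[of f g] by eventually_elim (simp add: distrib_right)
  qed measurable
  then show ?thesis
    by (simp add: fn_product_integrable)
qed

lemma pairing_scaleC_left:
  "(LINT x|lborel. fn (c *\<^sub>C f) x * cnj (fn h x)) = c * (LINT x|lborel. fn f x * cnj (fn h x))"
proof -
  have "(LINT x|lborel. fn (c *\<^sub>C f) x * cnj (fn h x)) =
      (LINT x|lborel. c * (fn f x * cnj (fn h x)))"
  proof (rule integral_cong_AE)
    show "AE x in lborel. fn (c *\<^sub>C f) x * cnj (fn h x) = c * (fn f x * cnj (fn h x))"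
      using fn_scaleC[of c f] by eventually_elim (simp add: mult.assoc)
  qed measurable
  then show ?thesis
    by simp
qed

lemma pairing_commute:
  "(LINT x|lborel. fn f x * cnj (fn g x)) = cnj (LINT x|lborel. fn g x * cnj (fn f x))"
  by (subst Bochner_Integration.integral_cnj[symmetric]) (simp add: mult.commute)

lemma pairing_self:
  "(LINT x|lborel. fn f x * cnj (fn f x)) = complex_of_real (LINT x|lborel. (cmod (fn f x))\<^sup>2)"
  by (subst integral_complex_of_real[symmetric]) (simp add: complex_norm_square[symmetric])

instance
proof
  fix f g h :: L2 and r :: real and U :: "L2 set"
  show "dist f g = norm (f - g)"
    by (rule dist_L2_def)
  show "sgn f = inverse (norm f) *\<^sub>R f"
    by (rule sgn_L2_def)
  show "uniformity = (INF e\<in>{0<..}. principal {(x, y::L2). dist x y < e})"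
    by (rule uniformity_L2_def)
  show "open U = (\<forall>x\<in>U. \<forall>\<^sub>F (x', y) in uniformity. x' = x \<longrightarrow> y \<in> U)"
    by (rule open_L2_def)
  show "inner f g = inner g f"
    unfolding inner_L2_def by (subst pairing_commute) simp
  show "inner (f + g) h = inner f h + inner g h"
    by (simp add: inner_L2_def pairing_add_left)
  show "inner (r *\<^sub>R f) g = r * inner f g"
    by (simp add: inner_L2_def scaleR_scaleC pairing_scaleC_left)
  have self: "inner f f = (LINT x|lborel. (cmod (fn f x))\<^sup>2)"
    by (simp add: inner_L2_def pairing_self)
  show "0 \<le> inner f f"
    by (simp add: self)
  show "norm f = sqrt (inner f f)"
    by (simp add: self norm_L2_eq)
  have "(LINT x|lborel. (cmod (fn f x))\<^sup>2) = 0 \<longleftrightarrow> (AE x in lborel. (cmod (fn f x))\<^sup>2 = 0)"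
    by (rule integral_nonneg_eq_0_iff_AE) (auto simp: fn_square_integrable)
  also have "\<dots> \<longleftrightarrow> f = 0"
    using rep_zero_L0 by (auto simp: L2_eq_iff zero_L2.rep_eq elim!: AE_mp)
  finally show "inner f f = 0 \<longleftrightarrow> f = 0"
    by (simp add: self)
qed

end

lemma L2_norm_square: "(norm (f::L2))\<^sup>2 = (LINT x|lborel. (cmod (fn f x))\<^sup>2)"
  by (simp add: norm_L2_eq)

lemma L2_nn_integral: "(\<integral>\<^sup>+x. ennreal ((cmod (fn f x))\<^sup>2) \<partial>lborel) = ennreal ((norm f)\<^sup>2)"
  unfolding L2_norm_square
  by (rule nn_integral_eq_integral) (auto simp: fn_square_integrable)


lemma L2_Cauchy_convergent:
  fixes X :: "nat \<Rightarrow> L2"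
  assumes "Cauchy X"
  shows "convergent X"
proof -
  have "\<exists>M. \<forall>m\<ge>M. \<forall>k\<ge>M. norm (X m - X k) < (1/4)^n" for n :: nat
    using CauchyD[OF assms, of "(1/4)^n"] by simp
  then obtain N where N: "norm (X m - X k) < (1/4)^n" if "m \<ge> N n" "k \<ge> N n" for n m k
    by metis
  define r where "r n = n + (\<Sum>i\<le>n. N i)" for n
  have r: "strict_mono r"
    by (rule strict_mono_Suc_iff[THEN iffD2]) (simp add: r_def)
  have r_ge: "r m \<ge> N n" if "m \<ge> n" for m n
  proof -
    have "N n \<le> (\<Sum>i\<le>m. N i)"
      using that by (intro member_le_sum) auto
    then show ?thesis
      by (simp add: r_def)
  qed
  have close: "norm (X (r m) - X (r n)) \<le> (1/4)^n" if "m \<ge> n" for m n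
    using N[OF r_ge[OF that] r_ge[OF order_refl]] by simp

  define u where "u n = fn (X (r n))" for n
  have u_meas [measurable]: "u n \<in> borel_measurable lborel" for n
    unfolding u_def by (rule fn_measurable)
  have diff: "(\<integral>\<^sup>+x. ennreal ((cmod (u m x - u n x))\<^sup>2) \<partial>lborel) \<le> ennreal (((1/4)^n)\<^sup>2)"
    if "m \<ge> n" for m n
  proof -
    have "(\<integral>\<^sup>+x. ennreal ((cmod (u m x - u n x))\<^sup>2) \<partial>lborel) =
        (\<integral>\<^sup>+x. ennreal ((cmod (fn (X (r m) - X (r n)) x))\<^sup>2) \<partial>lborel)"
    proof (rule nn_integral_cong_AE)
      show "AE x in lborel. ennreal ((cmod (u m x - u n x))\<^sup>2) =
          ennreal ((cmod (fn (X (r m) - X (r n)) x))\<^sup>2)"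
        using fn_minus[of "X (r m)" "X (r n)"] by eventually_elim (simp add: u_def)
    qed
    also have "\<dots> \<le> ennreal (((1/4)^n)\<^sup>2)"
      unfolding L2_nn_integral by (intro ennreal_leI power_mono close that) simp
    finally show ?thesis .
  qed

  have "(\<integral>\<^sup>+x. (\<Sum>n. ennreal (4^n * (cmod (u (Suc n) x - u n x))\<^sup>2)) \<partial>lborel) =
      (\<Sum>n. (\<integral>\<^sup>+x. ennreal (4^n * (cmod (u (Suc n) x - u n x))\<^sup>2) \<partial>lborel))"
    by (rule nn_integral_suminf) measurable
  also have "\<dots> \<le> (\<Sum>n. ennreal ((1/4)^n))"
  proof (rule suminf_le)
    fix n :: nat
    have "(\<integral>\<^sup>+x. ennreal (4^n * (cmod (u (Suc n) x - u n x))\<^sup>2) \<partial>lborel) =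
        ennreal (4^n) * (\<integral>\<^sup>+x. ennreal ((cmod (u (Suc n) x - u n x))\<^sup>2) \<partial>lborel)"
      by (subst nn_integral_cmult[symmetric]) (measurable, simp add: ennreal_mult')
    also have "\<dots> \<le> ennreal (4^n) * ennreal (((1/4)^n)\<^sup>2)"
      by (rule mult_left_mono[OF diff]) simp_all
    also have "\<dots> = ennreal (4^n * ((1/4)^n)\<^sup>2)"
      by (rule ennreal_mult'[symmetric]) simp
    also have "4^n * ((1/4)^n)\<^sup>2 = (1/4::real)^n"
      by (simp add: power2_eq_square field_simps)
    finally show "(\<integral>\<^sup>+x. ennreal (4^n * (cmod (u (Suc n) x - u n x))\<^sup>2) \<partial>lborel)
        \<le> ennreal ((1/4)^n)" .
  qed simp_all
  also have "\<dots> < top"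
    unfolding less_top[symmetric]
    by (rule ennreal_suminf_neq_top) (simp_all add: summable_geometric)
  finally have "(\<integral>\<^sup>+x. (\<Sum>n. ennreal (4^n * (cmod (u (Suc n) x - u n x))\<^sup>2)) \<partial>lborel) \<noteq> \<infinity>"
    by simp
  then have "AE x in lborel. (\<Sum>n. ennreal (4^n * (cmod (u (Suc n) x - u n x))\<^sup>2)) \<noteq> \<infinity>"
    by (intro nn_integral_PInf_AE) measurable
  then have conv: "AE x in lborel. convergent (\<lambda>n. u n x)"
  proof eventually_elim
    case (elim x)
    have "summable (\<lambda>n. 4^n * (cmod (u (Suc n) x - u n x))\<^sup>2)"
      by (rule summable_suminf_not_top) (use elim in simp_all)
    then have "Bseq (\<lambda>n. 4^n * (cmod (u (Suc n) x - u n x))\<^sup>2)"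
      by (intro convergent_imp_Bseq) (auto simp: convergent_def dest: summable_LIMSEQ_zero)
    then obtain K where K: "K > 0" "4^n * (cmod (u (Suc n) x - u n x))\<^sup>2 \<le> K" for n
      by (auto simp: Bseq_def)
    have "cmod (u (Suc n) x - u n x) \<le> sqrt K * (1/2)^n" for n
    proof (rule power2_le_imp_le)
      have "(cmod (u (Suc n) x - u n x))\<^sup>2 \<le> K / 4^n"
        using K(2)[of n] by (simp add: field_simps)
      also have "\<dots> = (sqrt K * (1/2)^n)\<^sup>2"
      proof -
        have "((1/2::real)^n)\<^sup>2 = (1/2 * (1/2))^n"
          unfolding power2_eq_square by (rule power_mult_distrib[symmetric])
        then show ?thesis
          using K(1) by (simp add: power_mult_distrib power_divide)
      qed
      finally show "(cmod (u (Suc n) x - u n x))\<^sup>2 \<le> (sqrt K * (1/2)^n)\<^sup>2" .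
    qed (use K(1) in simp)
    moreover have "summable (\<lambda>n. sqrt K * (1/2)^n)"
      by (intro summable_mult summable_geometric) simp
    ultimately have "summable (\<lambda>n. u (Suc n) x - u n x)"
      using summable_comparison_test'[of "\<lambda>n. sqrt K * (1/2)^n" 0 "\<lambda>n. u (Suc n) x - u n x"]
      by blast
    then obtain l where "(\<lambda>n. \<Sum>k<n. u (Suc k) x - u k x) \<longlonglongrightarrow> l"
      using summable_LIMSEQ by blast
    then have "(\<lambda>n. u n x - u 0 x) \<longlonglongrightarrow> l"
      using sum_lessThan_telescope[of "\<lambda>k. u k x"] by simp
    from tendsto_add[OF this tendsto_const[of "u 0 x"]] show ?case
      by (auto simp: convergent_def)
  qed

  define l where "l x = lim (\<lambda>n. u n x)" for x
  have l_meas [measurable]: "l \<in> borel_measurable lborel"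
    unfolding l_def by measurable
  have l_lim: "AE x in lborel. (\<lambda>n. u n x) \<longlonglongrightarrow> l x"
    using conv by eventually_elim (simp add: l_def convergent_LIMSEQ_iff)
  have l_diff: "(\<integral>\<^sup>+x. ennreal ((cmod (l x - u n x))\<^sup>2) \<partial>lborel) \<le> ennreal (((1/4)^n)\<^sup>2)" for n
  proof -
    have "(\<integral>\<^sup>+x. ennreal ((cmod (l x - u n x))\<^sup>2) \<partial>lborel) =
        (\<integral>\<^sup>+x. liminf (\<lambda>m. ennreal ((cmod (u m x - u n x))\<^sup>2)) \<partial>lborel)"
    proof (rule nn_integral_cong_AE)
      show "AE x in lborel. ennreal ((cmod (l x - u n x))\<^sup>2) =
          liminf (\<lambda>m. ennreal ((cmod (u m x - u n x))\<^sup>2))"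
        using l_lim
      proof eventually_elim
        case (elim x)
        have "(\<lambda>m. ennreal ((cmod (u m x - u n x))\<^sup>2)) \<longlonglongrightarrow> ennreal ((cmod (l x - u n x))\<^sup>2)"
          by (intro tendsto_intros elim)
        then show ?case
          by (intro lim_imp_Liminf[symmetric]) simp_all
      qed
    qed
    also have "\<dots> \<le> liminf (\<lambda>m. \<integral>\<^sup>+x. ennreal ((cmod (u m x - u n x))\<^sup>2) \<partial>lborel)"
      by (rule nn_integral_liminf) measurable
    also have "\<dots> \<le> liminf (\<lambda>m. ennreal (((1/4)^n)\<^sup>2))"
      by (rule Liminf_mono) (auto intro!: diff eventually_sequentiallyI[of n])
    also have "\<dots> = ennreal (((1/4)^n)\<^sup>2)"
      by (rule Liminf_const) simp
    finally show ?thesis .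
  qed

  define G where "G = abs_L0 l"
  have G_ae: "AE x in lborel. rep_L0 G x = l x"
    unfolding G_def by (rule rep_abs_L0[OF l_meas])
  have G_diff: "AE x in lborel. rep_L0 (G - Rep_L2 (X (r n))) x = l x - u n x" for n
    using G_ae rep_minus_L0[of G "Rep_L2 (X (r n))"] by eventually_elim (simp add: u_def)
  have G_diff_nn: "(\<integral>\<^sup>+x. ennreal ((cmod (rep_L0 (G - Rep_L2 (X (r n))) x))\<^sup>2) \<partial>lborel)
      \<le> ennreal (((1/4)^n)\<^sup>2)" for n
  proof -
    have "(\<integral>\<^sup>+x. ennreal ((cmod (rep_L0 (G - Rep_L2 (X (r n))) x))\<^sup>2) \<partial>lborel) =
        (\<integral>\<^sup>+x. ennreal ((cmod (l x - u n x))\<^sup>2) \<partial>lborel)"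
    proof (rule nn_integral_cong_AE)
      show "AE x in lborel. ennreal ((cmod (rep_L0 (G - Rep_L2 (X (r n))) x))\<^sup>2) =
          ennreal ((cmod (l x - u n x))\<^sup>2)"
        using G_diff[of n] by eventually_elim simp
    qed
    then show ?thesis
      using l_diff[of n] by simp
  qed
  have "G - Rep_L2 (X (r 0)) \<in> L2w 0"
    unfolding L2w_zero_iff
  proof (rule integrableI_bounded)
    show "(\<integral>\<^sup>+x. ennreal (norm ((cmod (rep_L0 (G - Rep_L2 (X (r 0))) x))\<^sup>2)) \<partial>lborel) < \<infinity>"
      using le_less_trans[OF G_diff_nn[of 0] ennreal_less_top] by simp
  qed measurable
  from add_in_L2w_zero[OF this Rep_L2[of "X (r 0)"]] have "G \<in> L2w 0"
    by simp
  define L where "L = Abs_L2 G"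
  have Rep_L: "Rep_L2 L = G"
    unfolding L_def by (rule Abs_L2_inverse) fact
  have "norm (L - X (r n)) \<le> (1/4)^n" for n
  proof (rule power2_le_imp_le)
    have "ennreal ((norm (L - X (r n)))\<^sup>2) \<le> ennreal (((1/4)^n)\<^sup>2)"
      using G_diff_nn[of n] by (simp add: minus_L2.rep_eq Rep_L flip: L2_nn_integral)
    then show "(norm (L - X (r n)))\<^sup>2 \<le> ((1/4)^n)\<^sup>2"
      by (subst (asm) ennreal_le_iff) simp_all
  qed simp
  then have "(\<lambda>n. X (r n)) \<longlonglongrightarrow> L"
    unfolding tendsto_dist_iff[of "\<lambda>n. X (r n)"]
    by (intro tendsto_sandwich[OF _ _ tendsto_const LIMSEQ_power_zero[of "1/4::real"]])
       (auto simp: dist_norm norm_minus_commute)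
  then have "X \<longlonglongrightarrow> L"
    by (intro Cauchy_converges_subseq[OF assms r]) (simp add: comp_def)
  then show ?thesis
    by (auto simp: convergent_def)
qed

instantiation L2 :: complex_hilbert_space
begin

definition cinner_L2 :: "L2 \<Rightarrow> L2 \<Rightarrow> complex" where
  "cinner_L2 f g = (LINT x|lborel. fn f x * cnj (fn g x))"

instance
proof
  fix f g h :: L2 and c :: complex
  show "convergent X" if "Cauchy X" for X :: "nat \<Rightarrow> L2"
    using that by (rule L2_Cauchy_convergent)
  show "cinner f g = cnj (cinner g f)"
    unfolding cinner_L2_def by (rule pairing_commute)
  show "cinner (f + g) h = cinner f h + cinner g h"
    unfolding cinner_L2_def by (rule pairing_add_left)
  show "cinner (c *\<^sub>C f) g = c * cinner f g"
    unfolding cinner_L2_def by (rule pairing_scaleC_left)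
  show "inner f g = Re (cinner f g)"
    by (simp add: inner_L2_def cinner_L2_def)
qed

end


section \<open>The operator \<open>-\<i> d/dx\<close> on \<open>H\<^sup>1(\<real>)\<close>\<close>

text \<open>Real-valued test functions suffice, by linearity.\<close>

definition test_functions :: "(real \<Rightarrow> real) set" where
  "test_functions =
     {\<phi>. (\<forall>n. (deriv ^^ n) \<phi> differentiable_on UNIV) \<and> compact (closure {x. \<phi> x \<noteq> 0})}"

definition has_weak_deriv :: "L2 \<Rightarrow> L2 \<Rightarrow> bool" where
  "has_weak_deriv f g \<longleftrightarrow>
     (\<forall>\<phi>\<in>test_functions.
        (LINT x|lborel. fn f x * complex_of_real (deriv \<phi> x)) =
        - (LINT x|lborel. fn g x * complex_of_real (\<phi> x)))"

definition H1 :: "L2 set" where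
  "H1 = {f. \<exists>g. has_weak_deriv f g}"

definition weak_deriv :: "L2 \<Rightarrow> L2" where
  "weak_deriv f = (THE g. has_weak_deriv f g)"

definition momentum :: "L2 \<Rightarrow> L2" where
  "momentum f = (- \<i>) *\<^sub>C weak_deriv f"


section \<open>Operators between weighted spaces\<close>

definition bounded_ops :: "real \<Rightarrow> real \<Rightarrow> (L0 \<Rightarrow> L0) set" where
  "bounded_ops s s' =
     {B. clinear_on (L2w s) B \<and> (\<forall>f\<in>L2w s. B f \<in> L2w s') \<and>
         (\<exists>C. \<forall>f\<in>L2w s. wnorm s' (B f) \<le> C * wnorm s f)}"

text \<open>The operator norm; the supremum is meaningful for \<open>B \<in> bounded_ops s s'\<close>.\<close>

definition op_norm :: "real \<Rightarrow> real \<Rightarrow> (L0 \<Rightarrow> L0) \<Rightarrow> real" where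
  "op_norm s s' B = Sup {wnorm s' (B f) |f. f \<in> L2w s \<and> wnorm s f \<le> 1}"

text \<open>
  An operator on \<open>L\<^sup>2\<close>, viewed as an operator from \<open>L2w s\<close> to \<open>L2w (- s)\<close> for \<open>s > 0\<close> through
  \<open>L2w s \<subseteq> L2w 0 \<subseteq> L2w (- s)\<close> (lemma \<open>L2w_mono\<close>), where \<open>L2w 0\<close> is the carrier of \<open>L2\<close>.
\<close>

definition via_L2 :: "(L2 \<Rightarrow> L2) \<Rightarrow> L0 \<Rightarrow> L0" where
  "via_L2 B f = Rep_L2 (B (Abs_L2 f))"

definition uniform_op_tendsto ::
    "real \<Rightarrow> real \<Rightarrow> ('t \<Rightarrow> L0 \<Rightarrow> L0) \<Rightarrow> (L0 \<Rightarrow> L0) \<Rightarrow> 't filter \<Rightarrow> bool" where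
  "uniform_op_tendsto s s' B L F \<longleftrightarrow>
     (\<forall>\<^sub>F t in F. B t \<in> bounded_ops s s') \<and> L \<in> bounded_ops s s' \<and>
     ((\<lambda>t. op_norm s s' (\<lambda>f. B t f - L f)) \<longlongrightarrow> 0) F"

end

theory Submission
  imports Defs
begin

text \<open>
  The group generated by \<open>\<i> H = d/dx\<close> is translation, \<open>(e\<^sup>i\<^sup>t\<^sup>H f)(x) = f (t + x)\<close>. A function in
  \<open>L\<^sup>2\<^sup>,\<^sup>\<sigma>\<close> with \<open>\<sigma> > 1/2\<close> is integrable, because \<open>(1 + x\<^sup>2)\<^sup>-\<^sup>\<sigma>\<close> is: by Cauchy-Schwarz
  \<open>\<parallel>f\<parallel>\<^sub>1 \<le> \<surd>K \<parallel>f\<parallel>\<^sub>\<sigma>\<close> with \<open>K = \<integral> (1 + x\<^sup>2)\<^sup>-\<^sup>\<sigma> dx\<close>. Tonelli's theorem then gives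
  \<open>|\<langle>\<integral>\<^bsub>[-T,T]\<^esub> e\<^sup>i\<^sup>t\<^sup>H f dt, g\<rangle>| \<le> \<integral>\<integral> |f (t + x)| |g x| dt dx = \<parallel>f\<parallel>\<^sub>1 \<parallel>g\<parallel>\<^sub>1 \<le> K \<parallel>f\<parallel>\<^sub>\<sigma> \<parallel>g\<parallel>\<^sub>\<sigma>\<close>
  uniformly in \<open>T\<close>. Since \<open>L\<^sup>2\<^sup>,\<^sup>-\<^sup>\<sigma>\<close> is dual to \<open>L\<^sup>2\<^sup>,\<^sup>\<sigma>\<close> under the \<open>L\<^sup>2\<close> pairing, the operator norm of
  the average is at most \<open>K / (2 T)\<close> (\<open>time_average_momentum_bound\<close>), which tends to zero.

  The larger part of the proof identifies \<open>e\<^sup>i\<^sup>t\<^sup>H\<close>. For an arbitrary strongly continuous unitary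
  group the following are shown.

  \<^item> If \<open>C\<close> is an invariant set of differentiable vectors that annihilates no nonzero vector, then the
    generator is determined weakly by its action on \<open>C\<close> (\<open>generator_from_core\<close>).

  \<^item> The generator is \<open>\<i>\<close> times a self-adjoint operator (\<open>self_adjoint_generator\<close>). This is the
    previous fact with the whole domain as \<open>C\<close>.

  \<^item> A self-adjoint operator, multiplied by \<open>\<i>\<close>, generates at most one group (\<open>exp_i_eqI\<close>).

  For translations, \<open>C\<close> consists of the classes of test functions. The weak relation is then word for
  word the definition of the weak derivative, so that the generator is \<open>d/dx\<close> on \<open>H\<^sup>1\<close>
  (\<open>translate_has_generator\<close>). That the test functions annihilate no nonzero element of \<open>L\<^sup>2\<close>
  (\<open>test_classes_separating\<close>) also gives strong continuity of translations: it is plain on test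
  functions, it passes to closed subspaces, and a separating subspace is dense by the projection
  theorem (\<open>csubspace_dense_if_separating\<close>).
\<close>

section \<open>Complex Hilbert spaces\<close>

lemma cinner_scaleC_right: "cinner x (c *\<^sub>C y) = cnj c * cinner x (y::'h::complex_hilbert_space)"
  by (metis cinner_commute cinner_scaleC_left complex_cnj_mult)

lemma scaleC_1: "1 *\<^sub>C x = (x::'h::complex_vector)"
  by (metis of_real_1 scaleR_one scaleR_scaleC)

lemma scaleC_0: "c *\<^sub>C 0 = (0::'h::complex_vector)"
  by (metis add_cancel_right_right scaleC_add_right)

lemma norm_scaleC: "norm (c *\<^sub>C x) = cmod c * norm (x::'h::complex_hilbert_space)"
proof -
  have im: "Im (cinner x x) = 0"
    using arg_cong[OF cinner_commute[of x x], of Im] by simp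
  have "inner (c *\<^sub>C x) (c *\<^sub>C x) = Re ((c * cnj c) * cinner x x)"
    by (simp add: inner_eq_Re_cinner cinner_scaleC_left cinner_scaleC_right mult_ac)
  also have "\<dots> = (cmod c)\<^sup>2 * inner x x"
    by (simp only: complex_norm_square[symmetric] inner_eq_Re_cinner) (simp add: im)
  finally have "inner (c *\<^sub>C x) (c *\<^sub>C x) = (cmod c)\<^sup>2 * inner x x" .
  then show ?thesis
    by (simp add: norm_eq_sqrt_inner real_sqrt_mult)
qed

lemma Im_cinner: "Im (cinner x y) = inner x (\<i> *\<^sub>C (y::'h::complex_hilbert_space))"
  by (simp add: inner_eq_Re_cinner cinner_scaleC_right)

lemma bounded_linear_cinner_left: "bounded_linear (\<lambda>x::'h::complex_hilbert_space. cinner x y)"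
proof (rule bounded_linear_intro)
  fix x z :: 'h and r :: real
  show "cinner (x + z) y = cinner x y + cinner z y"
    by (rule cinner_add_left)
  show "cinner (r *\<^sub>R x) y = r *\<^sub>R cinner x y"
    by (simp add: scaleR_scaleC cinner_scaleC_left scaleR_conv_of_real)
  have "cmod (cinner x y) \<le> \<bar>Re (cinner x y)\<bar> + \<bar>Im (cinner x y)\<bar>"
    by (rule cmod_le)
  also have "\<dots> \<le> norm x * norm y + norm x * norm (\<i> *\<^sub>C y)"
    unfolding Im_cinner inner_eq_Re_cinner[symmetric]
    by (intro add_mono Cauchy_Schwarz_ineq2)
  finally show "norm (cinner x y) \<le> norm x * (2 * norm y)"
    by (simp add: norm_scaleC)
qed

lemma bounded_linear_cinner_right: "bounded_linear (\<lambda>x::'h::complex_hilbert_space. cinner y x)"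
  by (subst cinner_commute)
     (rule bounded_linear_compose[OF bounded_linear_cnj bounded_linear_cinner_left])

lemma bounded_linear_scaleC: "bounded_linear (\<lambda>x::'h::complex_hilbert_space. c *\<^sub>C x)"
proof (rule bounded_linear_intro)
  fix x y :: 'h and r :: real
  show "c *\<^sub>C (x + y) = c *\<^sub>C x + c *\<^sub>C y"
    by (rule scaleC_add_right)
  show "c *\<^sub>C (r *\<^sub>R x) = r *\<^sub>R (c *\<^sub>C x)"
    by (simp add: scaleR_scaleC scaleC_scaleC mult.commute)
  show "norm (c *\<^sub>C x) \<le> norm x * cmod c"
    by (simp add: norm_scaleC)
qed

lemmas cinner_diff_left = linear_diff[OF bounded_linear.linear[OF bounded_linear_cinner_left]]
  and cinner_diff_right = linear_diff[OF bounded_linear.linear[OF bounded_linear_cinner_right]]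
  and cinner_minus_right = linear_neg[OF bounded_linear.linear[OF bounded_linear_cinner_right]]
  and cinner_minus_left = linear_neg[OF bounded_linear.linear[OF bounded_linear_cinner_left]]

lemma csubspace_scaleR: "csubspace S \<Longrightarrow> x \<in> S \<Longrightarrow> r *\<^sub>R x \<in> S"
  by (simp add: csubspace_def scaleR_scaleC)

lemma csubspace_minus: "csubspace S \<Longrightarrow> x \<in> S \<Longrightarrow> - x \<in> S"
  using csubspace_scaleR[of S x "-1"] by simp

lemma csubspace_diff: "csubspace S \<Longrightarrow> x \<in> S \<Longrightarrow> y \<in> S \<Longrightarrow> x - y \<in> S"
  using csubspace_minus[of S y] unfolding csubspace_def by (metis diff_conv_add_uminus)

text \<open>
  The projection theorem, in the form that avoids closed subspaces: a minimising sequence in \<open>S\<close>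
  for the distance to \<open>x\<close> is Cauchy by the parallelogram law, and the difference between \<open>x\<close> and
  its limit is orthogonal to \<open>S\<close>, hence zero.
\<close>

lemma csubspace_dense_if_separating:
  fixes S :: "'h::complex_hilbert_space set"
  assumes S: "csubspace S"
    and sep: "\<And>u. (\<And>c. c \<in> S \<Longrightarrow> cinner c u = 0) \<Longrightarrow> u = 0"
  shows "closure S = UNIV"
proof -
  have "x \<in> closure S" for x
  proof -
    have ne: "S \<noteq> {}"
      using S by (auto simp: csubspace_def)
    define d where "d = infdist x S"
    have d0: "d \<ge> 0"
      by (simp add: d_def infdist_nonneg)
    have d_le: "d \<le> norm (x - s)" if "s \<in> S" for s
      using infdist_le[OF that, of x] by (simp add: d_def dist_norm)
    have "\<exists>s\<in>S. norm (x - s) < d + inverse (real (Suc n))" for n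
    proof -
      have "(INF a\<in>S. dist x a) < d + inverse (real (Suc n))"
        using infdist_notempty[OF ne, of x] by (simp add: d_def)
      then show ?thesis
        using cInf_lessD[of "dist x ` S"] ne by (auto simp: dist_norm)
    qed
    then obtain s where sS: "s n \<in> S" and s_le: "norm (x - s n) < d + inverse (real (Suc n))" for n
      by metis
    have lim: "(\<lambda>n. norm (x - s n)) \<longlonglongrightarrow> d"
    proof (rule tendsto_sandwich)
      show "\<forall>\<^sub>F n in sequentially. d \<le> norm (x - s n)"
        using d_le[OF sS] by simp
      show "\<forall>\<^sub>F n in sequentially. norm (x - s n) \<le> d + inverse (real (Suc n))"
        by (intro always_eventually allI less_imp_le s_le)
      show "(\<lambda>n. d + inverse (real (Suc n))) \<longlonglongrightarrow> d"
        using tendsto_add[OF tendsto_const[of d] LIMSEQ_inverse_real_of_nat] by simp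
    qed simp
    have lim2: "(\<lambda>n. (norm (x - s n))\<^sup>2) \<longlonglongrightarrow> d\<^sup>2"
      by (intro tendsto_power lim)
    have par: "(norm (s m - s n))\<^sup>2 \<le> 2 * ((norm (x - s m))\<^sup>2 - d\<^sup>2) + 2 * ((norm (x - s n))\<^sup>2 - d\<^sup>2)"
      for m n
    proof -
      have "(1/2) *\<^sub>R (s m + s n) \<in> S"
        using S sS by (intro csubspace_scaleR[OF S]) (auto simp: csubspace_def)
      from d_le[OF this] have "d\<^sup>2 \<le> (norm (x - (1/2) *\<^sub>R (s m + s n)))\<^sup>2"
        using d0 by (intro power_mono)
      moreover have "(norm (s m - s n))\<^sup>2 + 4 * (norm (x - (1/2) *\<^sub>R (s m + s n)))\<^sup>2
          = 2 * (norm (x - s m))\<^sup>2 + 2 * (norm (x - s n))\<^sup>2"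
        by (simp add: power2_norm_eq_inner inner_diff_left inner_diff_right inner_add_left
            inner_add_right inner_commute algebra_simps)
      ultimately show ?thesis
        by simp
    qed
    have "Cauchy s"
    proof (rule CauchyI)
      fix e :: real assume e: "e > 0"
      have "\<forall>\<^sub>F n in sequentially. (norm (x - s n))\<^sup>2 < d\<^sup>2 + e\<^sup>2 / 4"
        using order_tendstoD(2)[OF lim2, of "d\<^sup>2 + e\<^sup>2 / 4"] e by simp
      then obtain N where N: "(norm (x - s n))\<^sup>2 < d\<^sup>2 + e\<^sup>2 / 4" if "n \<ge> N" for n
        by (auto simp: eventually_sequentially)
      have "norm (s m - s n) < e" if "m \<ge> N" "n \<ge> N" for m n
      proof (rule power2_less_imp_less)
        show "(norm (s m - s n))\<^sup>2 < e\<^sup>2"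
          using par[of m n] N[OF that(1)] N[OF that(2)] by simp
      qed (use e in simp)
      then show "\<exists>N. \<forall>m\<ge>N. \<forall>n\<ge>N. norm (s m - s n) < e"
        by blast
    qed
    then obtain y where y: "s \<longlonglongrightarrow> y"
      by (auto simp: Cauchy_convergent_iff convergent_def)
    have y_closure: "y \<in> closure S"
      using y sS by (auto simp: closure_sequential)
    have dist_y: "norm (x - y) = d"
      using LIMSEQ_unique[OF tendsto_norm[OF tendsto_diff[OF tendsto_const y]] lim] .
    have orth: "inner c (x - y) = 0" if c: "c \<in> S" for c
    proof (rule ccontr)
      assume ne0: "inner c (x - y) \<noteq> 0"
      then have c0: "inner c c > 0"
        by auto
      have ge: "d\<^sup>2 \<le> (norm (x - y - r *\<^sub>R c))\<^sup>2" for r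
      proof (rule power_mono[OF _ d0])
        have "(\<lambda>n. norm (x - (s n + r *\<^sub>R c))) \<longlonglongrightarrow> norm (x - (y + r *\<^sub>R c))"
          by (intro tendsto_intros y)
        moreover have "d \<le> norm (x - (s n + r *\<^sub>R c))" for n
          using S sS[of n] csubspace_scaleR[OF S c, of r] by (intro d_le) (auto simp: csubspace_def)
        ultimately have "d \<le> norm (x - (y + r *\<^sub>R c))"
          by (meson LIMSEQ_le_const)
        then show "d \<le> norm (x - y - r *\<^sub>R c)"
          by (simp add: algebra_simps)
      qed
      \<comment> \<open>the value of \<open>r\<close> that minimises the quadratic polynomial on the right of \<open>ge\<close>\<close>
      define r where "r = inner c (x - y) / inner c c"
      have "(norm (x - y - r *\<^sub>R c))\<^sup>2 = (norm (x - y))\<^sup>2 - 2 * r * inner c (x - y) + r\<^sup>2 * inner c c"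
        unfolding power2_norm_eq_inner
        by (simp add: inner_diff_left inner_diff_right inner_commute algebra_simps power2_eq_square)
      also have "\<dots> = d\<^sup>2 - (inner c (x - y))\<^sup>2 / inner c c"
        using c0 by (simp add: r_def dist_y power2_eq_square field_simps)
      finally have "(inner c (x - y))\<^sup>2 / inner c c \<le> 0"
        using ge[of r] by simp
      then show False
        using c0 ne0 by (simp add: divide_le_0_iff)
    qed
    have "cinner c (x - y) = 0" if c: "c \<in> S" for c
    proof -
      \<comment> \<open>the imaginary part of the pairing with \<open>c\<close> is the real part of the one with \<open>- \<i> c\<close>\<close>
      have "(-\<i>) *\<^sub>C c \<in> S"
        using S c by (simp add: csubspace_def)
      from orth[OF this] orth[OF c] show ?thesis
        by (simp add: inner_eq_Re_cinner cinner_scaleC_left complex_eq_iff)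
    qed
    from sep[OF this] have "x = y"
      by simp
    with y_closure show ?thesis
      by simp
  qed
  then show ?thesis by auto
qed

section \<open>Unitary groups and their generators\<close>

lemma has_vector_derivative_at_0_iff:
  fixes f :: "real \<Rightarrow> 'a::real_normed_vector"
  shows "(f has_vector_derivative h) (at 0) \<longleftrightarrow> ((\<lambda>t. (1 / t) *\<^sub>R (f t - f 0)) \<longlongrightarrow> h) (at 0)"
proof -
  have "(f has_vector_derivative h) (at 0) \<longleftrightarrow>
      ((\<lambda>t. norm (f t - f 0 - t *\<^sub>R h) / norm t) \<longlongrightarrow> 0) (at 0)"
    by (simp add: has_vector_derivative_def has_derivative_at bounded_linear_scaleR_left)
  also have "\<dots> \<longleftrightarrow> ((\<lambda>t. norm ((1 / t) *\<^sub>R (f t - f 0) - h)) \<longlongrightarrow> 0) (at 0)"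
  proof (rule filterlim_cong[OF refl refl])
    show "\<forall>\<^sub>F t in at 0. norm (f t - f 0 - t *\<^sub>R h) / norm t = norm ((1 / t) *\<^sub>R (f t - f 0) - h)"
    proof (rule eventually_at_filter[THEN iffD2, OF always_eventually], intro allI impI)
      fix t :: real assume "t \<noteq> 0"
      then have "(1 / t) *\<^sub>R (f t - f 0) - h = (1 / t) *\<^sub>R (f t - f 0 - t *\<^sub>R h)"
        by (simp add: scaleR_right_diff_distrib)
      then show "norm (f t - f 0 - t *\<^sub>R h) / norm t = norm ((1 / t) *\<^sub>R (f t - f 0) - h)"
        by simp
    qed
  qed
  also have "\<dots> \<longleftrightarrow> ((\<lambda>t. (1 / t) *\<^sub>R (f t - f 0)) \<longlongrightarrow> h) (at 0)"
    by (subst tendsto_norm_zero_iff) (rule LIM_zero_iff)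
  finally show ?thesis .
qed

text \<open>
  Stated through derivatives of orbits, the generator becomes accessible to the calculus of vector
  derivatives.
\<close>

lemma has_generator_iff:
  assumes "unitary_group U"
  shows "has_generator U D G \<longleftrightarrow>
    (\<forall>f h. ((\<lambda>t. U t f) has_vector_derivative h) (at 0) \<longleftrightarrow> f \<in> D \<and> h = G f)"
  using assms by (simp add: has_generator_def has_vector_derivative_at_0_iff unitary_group_def)

context
  fixes U :: "real \<Rightarrow> 'h::complex_hilbert_space \<Rightarrow> 'h"
  assumes U: "unitary_group U"
begin

lemma unitary_group_add_arg: "U (s + t) f = U s (U t f)"
  using U by (simp add: unitary_group_def)

lemma unitary_group_commute: "U s (U t f) = U t (U s f)"
  by (metis add.commute unitary_group_add_arg)

lemma unitary_group_0: "U 0 f = f"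
  using U by (simp add: unitary_group_def)

lemma unitary_group_cinner: "cinner (U t f) (U t g) = cinner f g"
  using U by (simp add: unitary_group_def unitary_def)

lemma unitary_group_cinner_adjoint: "cinner (U t f) g = cinner f (U (- t) g)"
  using unitary_group_cinner[of t f "U (- t) g"]
  by (simp add: unitary_group_0 flip: unitary_group_add_arg)

lemma unitary_group_norm: "norm (U t f) = norm f"
  by (simp add: norm_eq_sqrt_inner inner_eq_Re_cinner unitary_group_cinner)

lemma unitary_group_add: "U t (f + g) = U t f + U t g"
  and unitary_group_scaleC: "U t (c *\<^sub>C f) = c *\<^sub>C U t f"
  using U by (simp_all add: unitary_group_def unitary_def clinear_on_def)

lemma unitary_group_bounded_linear: "bounded_linear (U t)"
  by (rule bounded_linear_intro[where K = 1])
     (simp_all add: unitary_group_add unitary_group_scaleC scaleR_scaleC unitary_group_norm)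

lemma unitary_group_continuous: "continuous_on S (\<lambda>t. U t f)"
  using U by (auto simp: unitary_group_def intro: continuous_on_subset[OF _ subset_UNIV])

lemma unitary_group_derivative_at_0:
  assumes "((\<lambda>t. U t f) has_vector_derivative h) (at 0)"
  shows "((\<lambda>t. U t (U s f)) has_vector_derivative U s h) (at 0)"
  using bounded_linear.has_vector_derivative[OF unitary_group_bounded_linear assms, of s]
  by (simp add: unitary_group_commute[of s])

lemma unitary_group_derivative:
  assumes "((\<lambda>t. U t f) has_vector_derivative h) (at 0)"
  shows "((\<lambda>t. U t f) has_vector_derivative U s h) (at s)"
proof -
  have *: "((\<lambda>t. t - s) has_vector_derivative 1) (at s)"
    by (auto intro!: derivative_eq_intros)
  have "((\<lambda>t. U (t - s) (U s f)) has_vector_derivative U s h) (at s)"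
    using vector_diff_chain_at[OF *, of "\<lambda>t. U t (U s f)"] unitary_group_derivative_at_0[OF assms]
    by (simp add: comp_def)
  then show ?thesis
    by (simp flip: unitary_group_add_arg)
qed

lemma unitary_group_derivative_reverse:
  assumes "((\<lambda>t. U t f) has_vector_derivative h) (at 0)"
  shows "((\<lambda>t. U (- t) f) has_vector_derivative - U (- s) h) (at s)"
proof -
  have *: "(uminus has_vector_derivative (- 1)) (at (s::real))"
    by (auto intro!: derivative_eq_intros)
  show ?thesis
    using vector_diff_chain_at[OF *, of "\<lambda>t. U t f"] unitary_group_derivative[OF assms]
    by (simp add: comp_def)
qed

lemma generator_skew_symmetric:
  assumes "((\<lambda>t. U t f) has_vector_derivative f') (at 0)"
    and "((\<lambda>t. U t g) has_vector_derivative g') (at 0)"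
  shows "cinner f' g = - cinner f g'"
proof -
  have "((\<lambda>t. cinner (U t f) g) has_vector_derivative cinner f' g) (at 0)"
    by (rule bounded_linear.has_vector_derivative[OF bounded_linear_cinner_left assms(1)])
  moreover have "((\<lambda>t. cinner f (U (- t) g)) has_vector_derivative cinner f (- U (- 0) g')) (at 0)"
    by (rule bounded_linear.has_vector_derivative[OF bounded_linear_cinner_right
          unitary_group_derivative_reverse[OF assms(2)]])
  ultimately show ?thesis
    by (simp add: unitary_group_cinner_adjoint unitary_group_0 cinner_minus_right)
       (metis vector_derivative_unique_at)
qed

text \<open>
  A weak relation on a core implies the strong one. The orbit of \<open>g\<close> and \<open>g + \<integral>\<^sub>0\<^sup>t U s k ds\<close> have, paired
  with any \<open>c \<in> C\<close>, the same derivative in \<open>t\<close>, since \<open>\<langle>c, U t g\<rangle> = \<langle>U (- t) c, g\<rangle>\<close> and \<open>U (- t) c\<close>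
  is again in \<open>C\<close>. As \<open>C\<close> separates points they coincide, and the integral is differentiable in norm by
  continuity of \<open>s \<mapsto> U s k\<close>.
\<close>

lemma generator_from_core:
  assumes C: "\<And>c. c \<in> C \<Longrightarrow> ((\<lambda>t. U t c) has_vector_derivative G c) (at 0)"
    and inv: "\<And>c t. c \<in> C \<Longrightarrow> U t c \<in> C"
    and sep: "\<And>u. (\<And>c. c \<in> C \<Longrightarrow> cinner c u = 0) \<Longrightarrow> u = 0"
    and adj: "\<And>c. c \<in> C \<Longrightarrow> cinner (G c) g = - cinner c k"
  shows "((\<lambda>t. U t g) has_vector_derivative k) (at 0)"
proof -
  \<comment> \<open>the primitive of the orbit of \<open>k\<close> vanishing at \<open>0\<close>; the base point \<open>-1\<close> makes it an ordinary
    integral over an interval on both sides of \<open>0\<close>\<close>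
  define F where "F t = integral {-1..t} (\<lambda>s. U s k) - integral {-1..0} (\<lambda>s. U s k)" for t
  have F: "(F has_vector_derivative U t k) (at t)" if "t \<in> {-1<..<1}" for t
  proof -
    have "((\<lambda>u. integral {-1..u} (\<lambda>s. U s k)) has_vector_derivative U t k) (at t within {-1..1})"
      using that by (intro integral_has_vector_derivative unitary_group_continuous) auto
    moreover have "at t within {-1..1} = at t"
      using that by (intro at_within_interior) simp
    ultimately have "((\<lambda>u. integral {-1..u} (\<lambda>s. U s k) - integral {-1..0} (\<lambda>s. U s k))
        has_vector_derivative U t k - 0) (at t)"
      by (intro has_vector_derivative_diff has_vector_derivative_const) simp
    then show ?thesis
      by (simp add: F_def[abs_def])
  qed
  have eq: "U t g = g + F t" if t: "t \<in> {-1<..<1}" for t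
  proof -
    have "cinner c (U t g - g - F t) = 0" if c: "c \<in> C" for c
    proof -
      define w where "w t = cinner c (U t g) - cinner c (F t)" for t
      have "(w has_vector_derivative 0) (at s)" if s: "s \<in> {-1<..<1}" for s
      proof -
        have "G (U (- s) c) = U (- s) (G c)"
          using C[OF inv[OF c]] unitary_group_derivative_at_0[OF C[OF c]]
          by (rule vector_derivative_unique_at)
        then have "cinner (- U (- s) (G c)) g = cinner c (U s k)"
          using adj[OF inv[OF c, of "- s"]] by (simp add: cinner_minus_left unitary_group_cinner_adjoint)
        moreover have "((\<lambda>t. cinner (U (- t) c) g) has_vector_derivative cinner (- U (- s) (G c)) g) (at s)"
          by (rule bounded_linear.has_vector_derivative[OF bounded_linear_cinner_left
                unitary_group_derivative_reverse[OF C[OF c]]])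
        ultimately have "((\<lambda>t. cinner c (U t g)) has_vector_derivative cinner c (U s k)) (at s)"
          by (simp add: unitary_group_cinner_adjoint)
        then have "(w has_vector_derivative cinner c (U s k) - cinner c (U s k)) (at s)"
          unfolding w_def
          by (intro has_vector_derivative_diff
              bounded_linear.has_vector_derivative[OF bounded_linear_cinner_right F[OF s]])
        then show ?thesis
          by simp
      qed
      then have "(w has_derivative (\<lambda>h. 0)) (at s within {-1<..<1})" if "s \<in> {-1<..<1}" for s
        using that by (simp add: has_vector_derivative_def has_derivative_at_withinI)
      then have "\<exists>z. \<forall>x\<in>{-1<..<1}. w x = z"
        by (intro has_derivative_zero_constant) simp_all
      then have "w t = w 0"
        using t by fastforce
      moreover have "F 0 = 0"
        by (simp add: F_def)
      ultimately show ?thesis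
        by (simp add: w_def unitary_group_0 cinner_diff_right diff_eq_eq
            linear_0[OF bounded_linear.linear[OF bounded_linear_cinner_right]])
    qed
    from sep[OF this] show ?thesis
      by (simp add: algebra_simps)
  qed
  have "((\<lambda>t. g + F t) has_vector_derivative U 0 k) (at 0)"
    using has_vector_derivative_add[OF has_vector_derivative_const F[of 0]] by simp
  then have "((\<lambda>t. U t g) has_vector_derivative U 0 k) (at 0)"
    by (rule has_vector_derivative_transform_within_open[where S = "{-1<..<1}"]) (auto simp: eq)
  then show ?thesis
    by (simp add: unitary_group_0)
qed

text \<open>
  The easy half of Stone's theorem. That the adjoint has no larger domain than the
  operator is \<open>generator_from_core\<close> with the whole domain as core; density of the domain follows from its
  separating points.
\<close>

lemma self_adjoint_generator:
  assumes gen: "has_generator U D G"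
    and sep: "\<And>u. (\<And>c. c \<in> D \<Longrightarrow> cinner c u = 0) \<Longrightarrow> u = 0"
  shows "self_adjoint D (\<lambda>f. (- \<i>) *\<^sub>C G f)"
proof -
  note iff = gen[unfolded has_generator_iff[OF U], rule_format]
  have D: "((\<lambda>t. U t f) has_vector_derivative G f) (at 0)" if "f \<in> D" for f
    using iff that by blast
  have add: "f + g \<in> D \<and> G f + G g = G (f + g)" if "f \<in> D" "g \<in> D" for f g
    using has_vector_derivative_add[OF D[OF that(1)] D[OF that(2)]]
    unfolding iff[symmetric] by (simp add: unitary_group_add)
  have scale: "c *\<^sub>C f \<in> D \<and> c *\<^sub>C G f = G (c *\<^sub>C f)" if "f \<in> D" for f c
    using bounded_linear.has_vector_derivative[OF bounded_linear_scaleC D[OF that], of c]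
    unfolding iff[symmetric] by (simp add: unitary_group_scaleC)
  have zero: "0 \<in> D"
  proof -
    have "U t 0 = 0" for t
      using linear_0[OF bounded_linear.linear[OF unitary_group_bounded_linear]] .
    then show ?thesis
      using iff[of 0 0] by simp
  qed
  have sub: "csubspace D"
    using zero add scale by (auto simp: csubspace_def)
  have lin: "clinear_on D (\<lambda>f. (- \<i>) *\<^sub>C G f)"
    unfolding clinear_on_def
  proof safe
    fix f g c assume fg: "f \<in> D" "g \<in> D"
    show "(- \<i>) *\<^sub>C G (f + g) = (- \<i>) *\<^sub>C G f + (- \<i>) *\<^sub>C G g"
      using add[OF fg] by (metis scaleC_add_right)
  next
    fix f c assume f: "f \<in> D"
    show "(- \<i>) *\<^sub>C G (c *\<^sub>C f) = c *\<^sub>C (- \<i>) *\<^sub>C G f"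
      using scale[OF f, of c] by (metis scaleC_scaleC mult.commute)
  qed
  have "(\<forall>f\<in>D. cinner ((- \<i>) *\<^sub>C G f) g = cinner f k) \<longleftrightarrow> g \<in> D \<and> k = (- \<i>) *\<^sub>C G g" for g k
  proof
    assume adj: "\<forall>f\<in>D. cinner ((- \<i>) *\<^sub>C G f) g = cinner f k"
    have adj': "cinner (G f) g = - cinner f (\<i> *\<^sub>C k)" if "f \<in> D" for f
      using adj that by (auto simp: cinner_scaleC_left cinner_scaleC_right complex_eq_iff)
    have "U t f \<in> D" if "f \<in> D" for t f
      using iff unitary_group_derivative_at_0[OF D[OF that]] by blast
    from generator_from_core[OF D this sep adj']
    have "((\<lambda>t. U t g) has_vector_derivative \<i> *\<^sub>C k) (at 0)"
      by simp
    then have "g \<in> D" "\<i> *\<^sub>C k = G g"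
      using iff by auto
    then show "g \<in> D \<and> k = (- \<i>) *\<^sub>C G g"
      by (auto simp: scaleC_scaleC scaleC_1 simp flip: \<open>\<i> *\<^sub>C k = G g\<close>)
  next
    assume g: "g \<in> D \<and> k = (- \<i>) *\<^sub>C G g"
    then show "\<forall>f\<in>D. cinner ((- \<i>) *\<^sub>C G f) g = cinner f k"
      using generator_skew_symmetric[OF D D] by (simp add: cinner_scaleC_left cinner_scaleC_right)
  qed
  then show ?thesis
    using sub lin csubspace_dense_if_separating[OF sub sep] by (auto simp: self_adjoint_def)
qed

end

text \<open>
  Uniqueness of the group: if \<open>w t\<close> is the difference of the two orbits of a vector of the domain, then
  \<open>w' = \<i> A w\<close>, and \<open>\<parallel>w\<parallel>\<^sup>2\<close> is constant because \<open>\<langle>A w, w\<rangle>\<close> is real. It vanishes at \<open>0\<close>. The domain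
  being dense, the groups agree everywhere.
\<close>

lemma exp_i_eqI:
  assumes A: "self_adjoint D A"
    and U: "unitary_group U"
    and genU: "has_generator U D (\<lambda>f. \<i> *\<^sub>C A f)"
  shows "exp_i D A = U"
  unfolding exp_i_def
proof (rule the_equality)
  show "unitary_group U \<and> has_generator U D (\<lambda>f. \<i> *\<^sub>C A f)"
    using U genU by simp
next
  fix V assume "unitary_group V \<and> has_generator V D (\<lambda>f. \<i> *\<^sub>C A f)"
  then have V: "unitary_group V" and genV: "has_generator V D (\<lambda>f. \<i> *\<^sub>C A f)"
    by auto
  have deriv: "W t f \<in> D \<and> ((\<lambda>t. W t f) has_vector_derivative \<i> *\<^sub>C A (W t f)) (at t)"
    if W: "unitary_group W" "has_generator W D (\<lambda>f. \<i> *\<^sub>C A f)" and f: "f \<in> D" for W t f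
  proof -
    have f': "((\<lambda>t. W t f) has_vector_derivative \<i> *\<^sub>C A f) (at 0)"
      using W(2) f unfolding has_generator_iff[OF W(1)] by blast
    then have "W t f \<in> D \<and> W t (\<i> *\<^sub>C A f) = \<i> *\<^sub>C A (W t f)"
      using W(2) unitary_group_derivative_at_0[OF W(1) f', of t]
      unfolding has_generator_iff[OF W(1)] by blast
    then show ?thesis
      using unitary_group_derivative[OF W(1) f', of t] by simp
  qed
  have sub: "csubspace D" and lin: "clinear_on D A" and dense: "closure D = UNIV"
    and sym: "\<And>f g. f \<in> D \<Longrightarrow> g \<in> D \<Longrightarrow> cinner (A f) g = cinner f (A g)"
    using A by (auto simp: self_adjoint_def)
  have eqD: "V t f = U t f" if f: "f \<in> D" for t f
  proof -
    define w where "w t = V t f - U t f" for t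
    have wD: "w t \<in> D" for t
      unfolding w_def using deriv[OF V genV f] deriv[OF U genU f] by (intro csubspace_diff[OF sub]) auto
    have A_w: "\<i> *\<^sub>C A (V t f) - \<i> *\<^sub>C A (U t f) = \<i> *\<^sub>C A (w t)" for t
    proof -
      have "A (w t + U t f) = A (w t) + A (U t f)"
        using lin wD deriv[OF U genU f] by (auto simp: clinear_on_def)
      then show ?thesis
        by (simp add: w_def scaleC_add_right)
    qed
    have w': "(w has_vector_derivative \<i> *\<^sub>C A (w t)) (at t)" for t
      unfolding w_def[abs_def] A_w[symmetric, unfolded w_def]
      using deriv[OF V genV f] deriv[OF U genU f] by (intro has_vector_derivative_diff) auto
    have skew: "inner (w t) (\<i> *\<^sub>C A (w t)) = 0" for t
    proof -
      have "Im (cinner (w t) (A (w t))) = 0"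
        using sym[OF wD wD, of t t] arg_cong[OF cinner_commute[of "w t" "A (w t)"], of Im] by simp
      then show ?thesis
        by (simp add: Im_cinner)
    qed
    have "((\<lambda>t. inner (w t) (w t)) has_derivative (\<lambda>h. 0)) (at t)" for t
      using has_derivative_inner[OF w'[unfolded has_vector_derivative_def] w'[unfolded has_vector_derivative_def]]
      by (simp add: skew inner_commute)
    then have "\<exists>z. \<forall>x\<in>UNIV. inner (w x) (w x) = z"
      by (intro has_derivative_zero_constant) auto
    then have "inner (w t) (w t) = inner (w 0) (w 0)"
      by auto
    then show ?thesis
      by (simp add: w_def unitary_group_0[OF U] unitary_group_0[OF V])
  qed
  have "V t f = U t f" for t f
  proof -
    have "closed {f. V t f = U t f}"
      using unitary_group_bounded_linear[OF U] unitary_group_bounded_linear[OF V]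
      by (intro closed_Collect_eq linear_continuous_on)
    then have "closure D \<subseteq> {f. V t f = U t f}"
      using eqD by (intro closure_minimal) auto
    then show ?thesis
      using dense by auto
  qed
  then show "V = U"
    by (intro ext)
qed

section \<open>Test functions\<close>

text \<open>
  For \<open>k = 0\<close> this is the classical smooth function that is flat at the origin. The negative powers are
  included because they occur in its derivatives.
\<close>

definition flat_exp :: "nat \<Rightarrow> real \<Rightarrow> real" where
  "flat_exp k x = (if x > 0 then exp (- inverse x) * inverse x ^ k else 0)"

lemma flat_exp_tendsto_0: "(flat_exp k \<longlongrightarrow> 0) (at 0)"
proof (rule filterlim_split_at)
  show "(flat_exp k \<longlongrightarrow> 0) (at_left 0)"
    by (rule tendsto_eventually) (auto simp: flat_exp_def eventually_at_filter)
  have "((\<lambda>x::real. inverse x ^ k / exp (inverse x)) \<longlongrightarrow> 0) (at_right 0)"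
    by (rule filterlim_compose[OF tendsto_power_div_exp_0 filterlim_inverse_at_top_right])
  then show "(flat_exp k \<longlongrightarrow> 0) (at_right 0)"
  proof (rule Lim_transform_eventually)
    show "\<forall>\<^sub>F x in at_right 0. inverse x ^ k / exp (inverse x) = flat_exp k x"
      by (auto simp: flat_exp_def eventually_at_filter exp_minus field_simps)
  qed
qed

lemma flat_exp_has_derivative:
  "(flat_exp k has_real_derivative flat_exp (k + 2) x - real k * flat_exp (k + 1) x) (at x)"
proof (cases x "0::real" rule: linorder_cases)
  case less
  have "((\<lambda>_. 0) has_real_derivative flat_exp (k + 2) x - real k * flat_exp (k + 1) x) (at x)"
    using less by (simp add: flat_exp_def)
  then show ?thesis
    by (rule DERIV_cong_ev[THEN iffD1, rotated -1])
       (use less in \<open>auto simp: flat_exp_def intro!: eventually_nhds_in_open[of "{..<0}", THEN eventually_mono]\<close>)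
next
  case equal
  \<comment> \<open>dividing \<open>flat_exp k\<close> by its argument raises the index by one\<close>
  have "((\<lambda>h. flat_exp k h / h) \<longlongrightarrow> 0) (at 0)"
  proof (rule Lim_transform_eventually[OF flat_exp_tendsto_0[of "Suc k"]])
    show "\<forall>\<^sub>F h in at 0. flat_exp (Suc k) h = flat_exp k h / h"
      by (simp add: flat_exp_def eventually_at_filter field_simps)
  qed
  then show ?thesis
    using equal by (simp add: DERIV_def flat_exp_def)
next
  case greater
  have inv: "(inverse has_real_derivative - (inverse x ^ 2)) (at x)"
    using DERIV_inverse[of x] greater by (simp add: power_inverse numeral_2_eq_2)
  have "((\<lambda>x. inverse x ^ k) has_real_derivative - (real k * inverse x ^ (k + 1))) (at x)"
    using DERIV_power[OF inv, of k] by (cases k) (simp_all add: power2_eq_square mult_ac)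
  moreover have "((\<lambda>x. exp (- inverse x)) has_real_derivative exp (- inverse x) * inverse x ^ 2) (at x)"
    using DERIV_chain2[OF DERIV_exp DERIV_minus[OF inv]] by simp
  ultimately have "((\<lambda>x. exp (- inverse x) * inverse x ^ k) has_real_derivative
      exp (- inverse x) * inverse x ^ 2 * inverse x ^ k +
      - (real k * inverse x ^ (k + 1)) * exp (- inverse x)) (at x)"
    by (rule DERIV_mult[rotated])
  then have "((\<lambda>x. exp (- inverse x) * inverse x ^ k) has_real_derivative
      flat_exp (k + 2) x - real k * flat_exp (k + 1) x) (at x)"
    using greater by (simp add: flat_exp_def power2_eq_square mult_ac)
  then show ?thesis
    by (rule DERIV_cong_ev[THEN iffD1, rotated -1])
       (use greater in \<open>auto simp: flat_exp_def intro!: eventually_nhds_in_open[of "{0<..}", THEN eventually_mono]\<close>)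
qed

text \<open>
  A set of functions that is closed under differentiation consists of smooth functions. This one is
  large enough to contain the bump functions.
\<close>

inductive_set flat_exp_algebra :: "(real \<Rightarrow> real) set" where
  affine: "(\<lambda>x. flat_exp k (a * x + b)) \<in> flat_exp_algebra"
| const: "(\<lambda>x. c) \<in> flat_exp_algebra"
| add: "\<lbrakk>f \<in> flat_exp_algebra; g \<in> flat_exp_algebra\<rbrakk> \<Longrightarrow> (\<lambda>x. f x + g x) \<in> flat_exp_algebra"
| mult: "\<lbrakk>f \<in> flat_exp_algebra; g \<in> flat_exp_algebra\<rbrakk> \<Longrightarrow> (\<lambda>x. f x * g x) \<in> flat_exp_algebra"

lemma flat_exp_algebra_derivative:
  "f \<in> flat_exp_algebra \<Longrightarrow> \<exists>f'\<in>flat_exp_algebra. \<forall>x. (f has_real_derivative f' x) (at x)"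
proof (induction rule: flat_exp_algebra.induct)
  case (affine k a b)
  have "(\<lambda>x. a * (flat_exp (k + 2) (a * x + b) + (- real k) * flat_exp (k + 1) (a * x + b)))
      \<in> flat_exp_algebra"
    by (intro flat_exp_algebra.intros)
  moreover have "((\<lambda>x. flat_exp k (a * x + b)) has_real_derivative
      a * (flat_exp (k + 2) (a * x + b) + (- real k) * flat_exp (k + 1) (a * x + b))) (at x)" for x
  proof -
    have "((\<lambda>x. a * x + b) has_real_derivative a) (at x)"
      by (auto intro!: derivative_eq_intros)
    from DERIV_chain2[OF flat_exp_has_derivative this] show ?thesis
      by (simp add: mult.commute)
  qed
  ultimately show ?case
    by (intro bexI) auto
next
  case (const c)
  show ?case
    by (intro bexI[of _ "\<lambda>_. 0"] flat_exp_algebra.const) simp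
next
  case (add f g)
  then obtain f' g' where f': "f' \<in> flat_exp_algebra" "\<And>x. (f has_real_derivative f' x) (at x)"
    and g': "g' \<in> flat_exp_algebra" "\<And>x. (g has_real_derivative g' x) (at x)"
    by blast
  have "((\<lambda>x. f x + g x) has_real_derivative f' x + g' x) (at x)" for x
    by (rule DERIV_add[OF f'(2) g'(2)])
  then show ?case
    using flat_exp_algebra.add[OF f'(1) g'(1)] by (intro bexI) auto
next
  case (mult f g)
  then obtain f' g' where f': "f' \<in> flat_exp_algebra" "\<And>x. (f has_real_derivative f' x) (at x)"
    and g': "g' \<in> flat_exp_algebra" "\<And>x. (g has_real_derivative g' x) (at x)"
    by blast
  have "((\<lambda>x. f x * g x) has_real_derivative f' x * g x + g' x * f x) (at x)" for x
    by (rule DERIV_mult[OF f'(2) g'(2)])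
  then show ?case
    using flat_exp_algebra.add[OF flat_exp_algebra.mult[OF f'(1) mult.hyps(2)]
        flat_exp_algebra.mult[OF g'(1) mult.hyps(1)]]
    by (intro bexI) auto
qed

lemma differentiable_on_UNIV_iff:
  fixes f :: "real \<Rightarrow> real"
  shows "f differentiable_on UNIV \<longleftrightarrow> (\<forall>x. (f has_real_derivative deriv f x) (at x))"
  by (metis DERIV_imp_deriv differentiable_on_def iso_tuple_UNIV_I real_differentiable_def)

lemma flat_exp_algebra_smooth:
  assumes "f \<in> flat_exp_algebra"
  shows "(deriv ^^ n) f differentiable_on UNIV"
proof -
  have *: "deriv g \<in> flat_exp_algebra \<and> g differentiable_on UNIV" if "g \<in> flat_exp_algebra" for g
  proof -
    from flat_exp_algebra_derivative[OF that]
    obtain g' where g': "g' \<in> flat_exp_algebra" "\<And>x. (g has_real_derivative g' x) (at x)"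
      by blast
    then have "deriv g = g'"
      by (intro ext DERIV_imp_deriv)
    then show ?thesis
      using g' by (simp add: differentiable_on_UNIV_iff)
  qed
  have "(deriv ^^ n) f \<in> flat_exp_algebra"
    by (induction n) (use assms * in auto)
  then show ?thesis
    using * by blast
qed

text \<open>
  A smooth function supported in \<open>[a, b]\<close>. The factor \<open>n + 1\<close> steepens its flanks, so that it tends to
  the indicator function of \<open>(a, b)\<close> as \<open>n\<close> grows.
\<close>

definition plateau :: "real \<Rightarrow> real \<Rightarrow> nat \<Rightarrow> real \<Rightarrow> real" where
  "plateau a b n x = flat_exp 0 (real (Suc n) * (x - a)) * flat_exp 0 (real (Suc n) * (b - x))"

lemma plateau_eq_0: "x \<notin> {a<..<b} \<Longrightarrow> plateau a b n x = 0"
  by (auto simp: plateau_def flat_exp_def zero_less_mult_iff)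

lemma plateau_bounds: "\<bar>plateau a b n x\<bar> \<le> indicator {a<..<b} x"
proof (cases "x \<in> {a<..<b}")
  case True
  have *: "0 \<le> flat_exp 0 y \<and> flat_exp 0 y \<le> 1" for y
    by (simp add: flat_exp_def)
  show ?thesis
    using True * by (simp add: plateau_def abs_mult mult_le_one del: of_nat_Suc)
qed (simp add: plateau_eq_0)

lemma plateau_test_function: "plateau a b n \<in> test_functions"
proof -
  have "(\<lambda>x. flat_exp 0 (real (Suc n) * x + (- real (Suc n) * a)) *
      flat_exp 0 ((- real (Suc n)) * x + real (Suc n) * b)) \<in> flat_exp_algebra"
    by (intro flat_exp_algebra.intros)
  also have "(\<lambda>x. flat_exp 0 (real (Suc n) * x + (- real (Suc n) * a)) *
      flat_exp 0 ((- real (Suc n)) * x + real (Suc n) * b)) = plateau a b n"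
    by (simp add: plateau_def[abs_def] algebra_simps)
  finally have "plateau a b n \<in> flat_exp_algebra" .
  moreover have "bounded {x. plateau a b n x \<noteq> 0}"
    by (rule bounded_subset[of "{a<..<b}"]) (simp, use plateau_eq_0[of _ a b n] in blast)
  ultimately show ?thesis
    by (simp add: test_functions_def flat_exp_algebra_smooth)
qed

lemma plateau_tendsto: "(\<lambda>n. plateau a b n x) \<longlonglongrightarrow> indicator {a<..<b} x"
proof (cases "x \<in> {a<..<b}")
  case True
  have *: "(\<lambda>n. flat_exp 0 (real (Suc n) * c)) \<longlonglongrightarrow> 1" if "c > 0" for c
  proof -
    have "(\<lambda>n. exp (- (inverse (real (Suc n)) * inverse c))) \<longlonglongrightarrow> exp (- (0 * inverse c))"
      by (intro tendsto_intros LIMSEQ_inverse_real_of_nat)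
    then show ?thesis
      using that by (simp add: flat_exp_def zero_less_mult_iff del: of_nat_Suc)
  qed
  have "(\<lambda>n. plateau a b n x) \<longlonglongrightarrow> 1 * 1"
    unfolding plateau_def using True by (intro tendsto_mult *) auto
  then show ?thesis
    using True by simp
qed (simp add: plateau_eq_0)

lemma test_function_has_derivative:
  "\<phi> \<in> test_functions \<Longrightarrow> (\<phi> has_real_derivative deriv \<phi> x) (at x)"
  by (auto simp: test_functions_def differentiable_on_UNIV_iff dest: spec[of _ 0])

lemma test_function_continuous: "\<phi> \<in> test_functions \<Longrightarrow> continuous_on S \<phi>"
  by (meson DERIV_continuous_on has_field_derivative_at_within test_function_has_derivative)

lemma test_function_measurable: "\<phi> \<in> test_functions \<Longrightarrow> \<phi> \<in> borel_measurable borel"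
  by (intro borel_measurable_continuous_onI test_function_continuous)

lemma test_function_bound:
  assumes "\<phi> \<in> test_functions"
  obtains M R where "M \<ge> 0" "R \<ge> 0" "\<And>x. \<bar>\<phi> x\<bar> \<le> M * indicator {-R..R} x"
proof -
  have "bounded {x. \<phi> x \<noteq> 0}"
    using assms by (simp add: test_functions_def)
  then obtain R where R: "R > 0" "\<And>x. \<phi> x \<noteq> 0 \<Longrightarrow> \<bar>x\<bar> \<le> R"
    by (auto simp: bounded_pos)
  have "bounded (\<phi> ` {-R..R})"
    by (intro compact_imp_bounded compact_continuous_image test_function_continuous assms) simp
  then obtain M where M: "M > 0" "\<And>x. x \<in> {-R..R} \<Longrightarrow> \<bar>\<phi> x\<bar> \<le> M"
    by (auto simp: bounded_pos)
  show ?thesis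
  proof (rule that)
    show "\<bar>\<phi> x\<bar> \<le> M * indicator {-R..R} x" for x
      using M(2)[of x] R(2)[of x] by (cases "\<phi> x = 0") (auto simp: indicator_def M(1) less_imp_le)
  qed (use M R in auto)
qed

lemma test_function_deriv:
  assumes "\<phi> \<in> test_functions"
  shows "deriv \<phi> \<in> test_functions"
proof -
  have "(deriv ^^ n) (deriv \<phi>) differentiable_on UNIV" for n
    using assms fun_cong[OF funpow_Suc_right[of n deriv], of \<phi>]
    by (simp add: test_functions_def del: funpow.simps) metis
  moreover have "{x. deriv \<phi> x \<noteq> 0} \<subseteq> closure {x. \<phi> x \<noteq> 0}"
  proof safe
    fix x assume d: "deriv \<phi> x \<noteq> 0"
    show "x \<in> closure {x. \<phi> x \<noteq> 0}"
    proof (rule ccontr)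
      assume "x \<notin> closure {x. \<phi> x \<noteq> 0}"
      then have "\<forall>\<^sub>F y in nhds x. y \<in> - closure {x. \<phi> x \<noteq> 0}"
        by (intro eventually_nhds_in_open) auto
      then have "\<forall>\<^sub>F y in nhds x. \<phi> y = 0"
        by eventually_elim (use closure_subset[of "{x. \<phi> x \<noteq> 0}"] in auto)
      then have "deriv \<phi> x = deriv (\<lambda>_. 0) x"
        by (intro deriv_cong_ev) auto
      then show False
        using d by simp
    qed
  qed
  then have "bounded {x. deriv \<phi> x \<noteq> 0}"
    by (rule bounded_subset[rotated]) (use assms in \<open>simp add: test_functions_def bounded_closure\<close>)
  ultimately show ?thesis
    by (simp add: test_functions_def)
qed

lemma deriv_translate: "deriv (\<lambda>x. f (t + x)) = (\<lambda>x. deriv f (t + x))" for f :: "real \<Rightarrow> real"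
  by (rule ext) (simp add: deriv_def add.commute[of t] flip: DERIV_shift)

lemma test_function_translate:
  assumes "\<phi> \<in> test_functions"
  shows "(\<lambda>x. \<phi> (t + x)) \<in> test_functions"
proof -
  have "(deriv ^^ n) (\<lambda>x. \<phi> (t + x)) = (\<lambda>x. (deriv ^^ n) \<phi> (t + x))" for n
    by (induction n) (simp_all add: deriv_translate)
  moreover have "(\<lambda>x. (deriv ^^ n) \<phi> (t + x)) differentiable_on UNIV" for n
    unfolding differentiable_on_UNIV_iff deriv_translate
    using assms
    by (simp add: test_functions_def differentiable_on_UNIV_iff add.commute[of t]
        DERIV_shift[of "(deriv ^^ n) \<phi>", symmetric])
  moreover have "bounded {x. \<phi> (t + x) \<noteq> 0}"
  proof -
    have "bounded ((\<lambda>x. - t + x) ` {x. \<phi> x \<noteq> 0})"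
      using assms by (intro bounded_translation) (simp add: test_functions_def)
    then show ?thesis
      by (rule bounded_subset) (auto intro!: image_eqI[of _ _ "t + _"])
  qed
  ultimately show ?thesis
    by (simp add: test_functions_def)
qed

text \<open>
  On \<open>(- N, N)\<close>, the positive and the negative part of \<open>v\<close> are the densities of two finite measures,
  which agree on all half-lines and hence are equal.
\<close>

lemma AE_eq_0_if_interval_integrals_eq_0:
  fixes v :: "real \<Rightarrow> real"
  assumes [measurable]: "v \<in> borel_measurable lborel"
    and int: "\<And>a b. integrable lborel (\<lambda>x. indicator {a<..<b} x * v x)"
    and zero: "\<And>a b. (LINT x|lborel. indicator {a<..<b} x * v x) = 0"
  shows "AE x in lborel. v x = 0"
proof -
  have "AE x in lborel. indicator {- real N<..<real N} x * v x = 0" for N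
  proof -
    define h where "h x = indicator {- real N<..<real N} x * v x" for x
    have [measurable]: "h \<in> borel_measurable lborel"
      unfolding h_def by measurable
    have half: "(\<integral>\<^sup>+x. ennreal (h x) * indicator {y<..} x \<partial>lborel) < \<infinity> \<and>
        (\<integral>\<^sup>+x. ennreal (h x) * indicator {y<..} x \<partial>lborel) =
        (\<integral>\<^sup>+x. ennreal (- h x) * indicator {y<..} x \<partial>lborel)" for y
    proof -
      \<comment> \<open>the restriction of \<open>h\<close> to \<open>(y, \<infinity>)\<close> is again the restriction of \<open>v\<close> to an interval\<close>
      define w where "w x = indicator {max y (- real N)<..<real N} x * v x" for x
      have w: "integrable lborel w" "integral\<^sup>L lborel w = 0"
        unfolding w_def using int zero by auto
      have eq: "(\<integral>\<^sup>+x. ennreal (h x) * indicator {y<..} x \<partial>lborel) = (\<integral>\<^sup>+x. ennreal (w x) \<partial>lborel)"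
        "(\<integral>\<^sup>+x. ennreal (- h x) * indicator {y<..} x \<partial>lborel) = (\<integral>\<^sup>+x. ennreal (- w x) \<partial>lborel)"
        by (auto intro!: nn_integral_cong simp: h_def w_def indicator_def)
      show ?thesis
        unfolding eq using w real_lebesgue_integral_def[OF w(1)]
        by (simp add: real_integrable_def less_top) (metis ennreal_enn2real)
    qed
    have "density lborel (\<lambda>x. ennreal (h x)) = density lborel (\<lambda>x. ennreal (- h x))"
    proof (rule measure_eqI_lessThan)
      show "emeasure (density lborel (\<lambda>x. ennreal (h x))) {y<..} < \<infinity>" for y
        using conjunct1[OF half[of y]] by (simp add: emeasure_density)
      show "emeasure (density lborel (\<lambda>x. ennreal (h x))) {y<..} =
          emeasure (density lborel (\<lambda>x. ennreal (- h x))) {y<..}" for y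
        using half[of y] by (simp add: emeasure_density)
    qed simp_all
    then have "AE x in lborel. ennreal (h x) = ennreal (- h x)"
      by (intro sigma_finite_measure.density_unique[OF sigma_finite_lborel]) simp_all
    then show ?thesis
    proof eventually_elim
      case (elim x)
      then have "h x = 0"
        by (cases "h x \<ge> 0") (simp_all add: ennreal_neg ennreal_eq_0_iff)
      then show ?case
        by (simp add: h_def)
    qed
  qed
  then have "AE x in lborel. \<forall>N. indicator {- real N<..<real N} x * v x = 0"
    unfolding AE_all_countable by blast
  then show ?thesis
  proof eventually_elim
    case (elim x)
    obtain N where "\<bar>x\<bar> < real N"
      using reals_Archimedean2 by blast
    then show ?case
      using elim[rule_format, of N] by (simp add: indicator_def abs_less_iff)
  qed
qed

section \<open>The translation group\<close>

text \<open>
  Abstraction functions say nothing outside their domain, so this is meaningful only for measurable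
  square integrable functions.
\<close>

definition to_L2 :: "(real \<Rightarrow> complex) \<Rightarrow> L2" where
  "to_L2 f = Abs_L2 (abs_L0 f)"

lemma fn_to_L2:
  assumes "f \<in> borel_measurable lborel" "integrable lborel (\<lambda>x. (cmod (f x))\<^sup>2)"
  shows "AE x in lborel. fn (to_L2 f) x = f x"
proof -
  have eq: "AE x in lborel. rep_L0 (abs_L0 f) x = f x"
    by (rule rep_abs_L0[OF assms(1)])
  have "integrable lborel (\<lambda>x. (cmod (rep_L0 (abs_L0 f) x))\<^sup>2) \<longleftrightarrow> integrable lborel (\<lambda>x. (cmod (f x))\<^sup>2)"
    using assms(1) rep_L0_measurable[of "abs_L0 f"] eq
    by (intro integrable_cong_AE) (measurable, auto)
  then have "abs_L0 f \<in> L2w 0"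
    using assms(2) by (simp add: L2w_zero_iff)
  then show ?thesis
    using eq by (simp add: to_L2_def Abs_L2_inverse)
qed

definition translate :: "real \<Rightarrow> L2 \<Rightarrow> L2" where
  "translate t f = to_L2 (\<lambda>x. fn f (t + x))"

lemma AE_eq_translate:
  fixes f g :: "real \<Rightarrow> complex"
  assumes [measurable]: "f \<in> borel_measurable lborel" "g \<in> borel_measurable lborel"
    and "AE x in lborel. f x = g x"
  shows "AE x in lborel. f (t + x) = g (t + x)"
  using AE_borel_affine[of 1 "\<lambda>x. f x = g x" t] assms by simp

lemma fn_translate: "AE x in lborel. fn (translate t f) x = fn f (t + x)"
  unfolding translate_def
proof (rule fn_to_L2)
  show "integrable lborel (\<lambda>x. (cmod (fn f (t + x)))\<^sup>2)"
    using lborel_integrable_real_affine[OF fn_square_integrable, of 1 f t] by simp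
qed measurable

lemma translate_0: "translate 0 f = f"
  using fn_translate[of 0 f] by (simp add: L2_eq_iff)

lemma translate_add_arg: "translate (s + t) f = translate s (translate t f)"
proof -
  have "AE x in lborel. fn (translate t f) (s + x) = fn f (t + (s + x))"
    by (rule AE_eq_translate[OF _ _ fn_translate]) measurable
  then show ?thesis
    unfolding L2_eq_iff
    using fn_translate[of "s + t" f] fn_translate[of s "translate t f"]
    by eventually_elim (simp add: ac_simps)
qed

lemma translate_cinner: "cinner (translate t f) (translate t g) = cinner f g"
proof -
  have "cinner (translate t f) (translate t g) = (LINT x|lborel. fn f (t + x) * cnj (fn g (t + x)))"
    unfolding cinner_L2_def
  proof (rule integral_cong_AE)
    show "AE x in lborel. fn (translate t f) x * cnj (fn (translate t g) x) =
        fn f (t + x) * cnj (fn g (t + x))"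
      using fn_translate[of t f] fn_translate[of t g] by eventually_elim simp
  qed measurable
  also have "\<dots> = cinner f g"
    using lborel_integral_real_affine[of 1 "\<lambda>x. fn f x * cnj (fn g x)" t] by (simp add: cinner_L2_def)
  finally show ?thesis .
qed

lemma translate_plus: "translate t (f + g) = translate t f + translate t g"
proof -
  have "AE x in lborel. fn (f + g) (t + x) = fn f (t + x) + fn g (t + x)"
    by (rule AE_eq_translate[OF _ _ fn_plus]) measurable
  then show ?thesis
    unfolding L2_eq_iff
    using fn_translate[of t "f + g"] fn_translate[of t f] fn_translate[of t g]
      fn_plus[of "translate t f" "translate t g"]
    by eventually_elim simp
qed

lemma translate_scaleC: "translate t (c *\<^sub>C f) = c *\<^sub>C translate t f"
proof -
  have "AE x in lborel. fn (c *\<^sub>C f) (t + x) = c * fn f (t + x)"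
    by (rule AE_eq_translate[OF _ _ fn_scaleC]) measurable
  then show ?thesis
    unfolding L2_eq_iff
    using fn_translate[of t "c *\<^sub>C f"] fn_translate[of t f] fn_scaleC[of c "translate t f"]
    by eventually_elim simp
qed

lemma translate_unitary: "unitary (translate t)"
proof -
  have "translate t (translate (- t) f) = f" for f
    by (simp add: translate_0 flip: translate_add_arg)
  then have "surj (translate t)"
    by (metis surjI)
  then show ?thesis
    by (simp add: unitary_def clinear_on_def translate_plus translate_scaleC translate_cinner)
qed

definition test_class :: "(real \<Rightarrow> real) \<Rightarrow> L2" where
  "test_class \<phi> = to_L2 (\<lambda>x. complex_of_real (\<phi> x))"

lemma fn_test_class:
  assumes "\<phi> \<in> test_functions"
  shows "AE x in lborel. fn (test_class \<phi>) x = complex_of_real (\<phi> x)"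
  unfolding test_class_def
proof (rule fn_to_L2)
  have [measurable]: "\<phi> \<in> borel_measurable borel"
    by (rule test_function_measurable[OF assms])
  show "(\<lambda>x. complex_of_real (\<phi> x)) \<in> borel_measurable lborel"
    by measurable
  obtain M R where MR: "\<And>x. \<bar>\<phi> x\<bar> \<le> M * indicator {-R..R} x"
    using test_function_bound[OF assms] by blast
  show "integrable lborel (\<lambda>x. (cmod (complex_of_real (\<phi> x)))\<^sup>2)"
  proof (rule Bochner_Integration.integrable_bound)
    show "integrable lborel (\<lambda>x. M\<^sup>2 * indicator {-R..R} x :: real)"
      by (intro integrable_mult_right integrable_real_indicator emeasure_bounded_finite) auto
    show "AE x in lborel. norm ((cmod (complex_of_real (\<phi> x)))\<^sup>2) \<le> norm (M\<^sup>2 * indicator {-R..R} x :: real)"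
    proof (intro AE_I2)
      fix x
      show "norm ((cmod (complex_of_real (\<phi> x)))\<^sup>2) \<le> norm (M\<^sup>2 * indicator {-R..R} x :: real)"
        using power_mono[OF MR[of x] abs_ge_zero, of 2]
        by (simp add: power_mult_distrib power2_eq_square split: split_indicator_asm split_indicator)
    qed
  qed measurable
qed

lemma translate_test_class:
  assumes "\<phi> \<in> test_functions"
  shows "translate t (test_class \<phi>) = test_class (\<lambda>x. \<phi> (t + x))"
proof -
  have [measurable]: "\<phi> \<in> borel_measurable borel"
    by (rule test_function_measurable[OF assms])
  have "AE x in lborel. fn (test_class \<phi>) (t + x) = complex_of_real (\<phi> (t + x))"
    by (rule AE_eq_translate[OF _ _ fn_test_class[OF assms]]) measurable
  then show ?thesis
    unfolding L2_eq_iff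
    using fn_translate[of t "test_class \<phi>"]
      fn_test_class[OF test_function_translate[OF assms], of t]
    by eventually_elim simp
qed

lemma cinner_test_class:
  assumes "\<phi> \<in> test_functions"
  shows "cinner f (test_class \<phi>) = (LINT x|lborel. fn f x * complex_of_real (\<phi> x))"
proof -
  have [measurable]: "\<phi> \<in> borel_measurable borel"
    by (rule test_function_measurable[OF assms])
  show ?thesis
    unfolding cinner_L2_def
  proof (rule integral_cong_AE)
    show "AE x in lborel. fn f x * cnj (fn (test_class \<phi>) x) = fn f x * complex_of_real (\<phi> x)"
      using fn_test_class[OF assms] by eventually_elim simp
  qed measurable
qed

lemma has_weak_deriv_iff:
  "has_weak_deriv f g \<longleftrightarrow>
    (\<forall>\<phi>\<in>test_functions. cinner f (test_class (deriv \<phi>)) = - cinner g (test_class \<phi>))"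
  by (simp add: has_weak_deriv_def cinner_test_class test_function_deriv)

text \<open>
  The fundamental lemma of the calculus of variations: the smooth plateaus tend to the indicator
  functions of intervals, so that all integrals of \<open>u\<close> over bounded intervals vanish.
\<close>

lemma test_classes_separating:
  assumes "\<And>\<phi>. \<phi> \<in> test_functions \<Longrightarrow> cinner u (test_class \<phi>) = 0"
  shows "u = 0"
proof -
  have int: "integrable lborel (\<lambda>x. indicator {a<..<b} x * fn u x)" for a b
  proof (rule Bochner_Integration.integrable_bound)
    show "integrable lborel (\<lambda>x. (cmod (fn u x))\<^sup>2 + indicator {a<..<b} x :: real)"
      by (intro Bochner_Integration.integrable_add fn_square_integrable integrable_real_indicator
          emeasure_bounded_finite) auto
    have "y \<le> y\<^sup>2 + 1" for y :: real
      using zero_le_power2[of "y - 1/2"] by (simp add: power2_eq_square algebra_simps)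
    then show "AE x in lborel. norm (indicator {a<..<b} x * fn u x)
        \<le> norm ((cmod (fn u x))\<^sup>2 + indicator {a<..<b} x :: real)"
      by (intro AE_I2) (simp split: split_indicator)
  qed measurable
  have zero: "(LINT x|lborel. indicator {a<..<b} x * fn u x) = 0" for a b
  proof -
    have [measurable]: "plateau a b n \<in> borel_measurable borel" for n
      by (rule test_function_measurable[OF plateau_test_function])
    have "(\<lambda>n. LINT x|lborel. fn u x * complex_of_real (plateau a b n x)) \<longlonglongrightarrow>
        (LINT x|lborel. indicator {a<..<b} x * fn u x)"
    proof (rule integral_dominated_convergence)
      show "integrable lborel (\<lambda>x. norm (indicator {a<..<b} x * fn u x))"
        by (intro integrable_norm int)
      have "(\<lambda>n. fn u x * complex_of_real (plateau a b n x)) \<longlonglongrightarrow> indicator {a<..<b} x * fn u x" for x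
        using tendsto_mult[OF tendsto_const[of "fn u x"] tendsto_of_real[OF plateau_tendsto[of a b x]]]
        by (cases "x \<in> {a<..<b}") simp_all
      then show "AE x in lborel. (\<lambda>n. fn u x * complex_of_real (plateau a b n x))
          \<longlonglongrightarrow> indicator {a<..<b} x * fn u x"
        by simp
      have "norm (fn u x * complex_of_real (plateau a b n x)) \<le> norm (indicator {a<..<b} x * fn u x)" for n x
        using plateau_bounds[of a b n x]
        by (auto simp: norm_mult indicator_def mult_left_le)
      then show "AE x in lborel. norm (fn u x * complex_of_real (plateau a b n x))
          \<le> norm (indicator {a<..<b} x * fn u x)" for n
        by simp
    qed measurable
    moreover have "(LINT x|lborel. fn u x * complex_of_real (plateau a b n x)) = 0" for n
      using assms[OF plateau_test_function[of a b n]] by (simp add: cinner_test_class plateau_test_function)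
    ultimately show ?thesis
      by (simp add: LIMSEQ_const_iff)
  qed
  have part: "AE x in lborel. p (fn u x) = 0"
    if p: "bounded_linear p" "\<And>a b x. p (indicator {a<..<b} x * fn u x) = indicator {a<..<b} x * p (fn u x)"
    for p :: "complex \<Rightarrow> real"
  proof (rule AE_eq_0_if_interval_integrals_eq_0)
    show "(\<lambda>x. p (fn u x)) \<in> borel_measurable lborel"
      using p(1) by (intro borel_measurable_continuous_on[OF _ fn_measurable] linear_continuous_on)
    show "integrable lborel (\<lambda>x. indicator {a<..<b} x * p (fn u x))" for a b
      using integrable_bounded_linear[OF p(1) int[of a b]] by (simp add: p(2))
    show "(LINT x|lborel. indicator {a<..<b} x * p (fn u x)) = 0" for a b
      using integral_bounded_linear[OF p(1) int[of a b]] zero[of a b]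
      by (simp add: p(2) linear_0[OF bounded_linear.linear[OF p(1)]])
  qed
  have "AE x in lborel. Re (fn u x) = 0" "AE x in lborel. Im (fn u x) = 0"
    by (intro part bounded_linear_Re bounded_linear_Im; simp add: indicator_def)+
  then show ?thesis
    unfolding L2_eq_iff zero_L2.rep_eq using rep_zero_L0
    by eventually_elim (simp add: complex_eq_iff)
qed

text \<open>
  The difference quotients of \<open>\<phi>\<close> converge pointwise to \<open>\<phi>'\<close>; by the mean value theorem they are bounded
  by \<open>sup |\<phi>'|\<close>, and for \<open>|t| \<le> 1\<close> they have a common compact support. Dominated convergence gives
  convergence in \<open>L\<^sup>2\<close>.
\<close>

lemma test_class_has_derivative:
  assumes \<phi>: "\<phi> \<in> test_functions"
  shows "((\<lambda>t. translate t (test_class \<phi>)) has_vector_derivative test_class (deriv \<phi>)) (at 0)"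
proof -
  have [measurable]: "\<phi> \<in> borel_measurable borel" "deriv \<phi> \<in> borel_measurable borel"
    by (intro test_function_measurable test_function_deriv \<phi>)+
  define q where "q t x = (1 / t) * (\<phi> (t + x) - \<phi> x) - deriv \<phi> x" for t x
  have norm_eq: "norm ((1 / t) *\<^sub>R (translate t (test_class \<phi>) - test_class \<phi>) - test_class (deriv \<phi>))
      = sqrt (LINT x|lborel. (q t x)\<^sup>2)" for t
  proof -
    let ?w = "(1 / t) *\<^sub>R (translate t (test_class \<phi>) - test_class \<phi>)"
    have "AE x in lborel. fn (?w - test_class (deriv \<phi>)) x = complex_of_real (q t x)"
      using fn_minus[of ?w "test_class (deriv \<phi>)"] fn_test_class[OF test_function_deriv[OF \<phi>]]
        fn_scaleC[of "complex_of_real (1 / t)" "translate t (test_class \<phi>) - test_class \<phi>"]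
        fn_minus[of "translate t (test_class \<phi>)" "test_class \<phi>"] fn_test_class[OF \<phi>]
        fn_test_class[OF test_function_translate[OF \<phi>], of t, folded translate_test_class[OF \<phi>]]
      by eventually_elim (simp add: q_def scaleR_scaleC)
    then have "AE x in lborel. (cmod (fn (?w - test_class (deriv \<phi>)) x))\<^sup>2 = (q t x)\<^sup>2"
      by eventually_elim simp
    then show ?thesis
      unfolding norm_L2_eq by (subst integral_cong_AE) (auto simp: q_def)
  qed
  obtain R where R: "R \<ge> 0" "\<And>x. \<phi> x \<noteq> 0 \<Longrightarrow> x \<in> {-R..R}"
  proof -
    obtain M R where "R \<ge> 0" "\<And>x. \<bar>\<phi> x\<bar> \<le> M * indicator {-R..R} x"
      using test_function_bound[OF \<phi>] by metis
    then show ?thesis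
      using that[of R] by (metis abs_le_zero_iff indicator_simps(2) mult_zero_right)
  qed
  obtain M S where M: "M \<ge> 0" "\<And>x. \<bar>deriv \<phi> x\<bar> \<le> M * indicator {-S..S} x"
    using test_function_bound[OF test_function_deriv[OF \<phi>]] by metis
  have M': "\<bar>deriv \<phi> x\<bar> \<le> M" for x
    using M(2)[of x] M(1) by (cases "x \<in> {-S..S}") auto
  have q_bound: "\<bar>q t x\<bar> \<le> 2 * M" if "t \<noteq> 0" for t x
  proof -
    have "\<bar>\<phi> (t + x) - \<phi> x\<bar> \<le> M * \<bar>t + x - x\<bar>"
      using field_differentiable_bound[of UNIV \<phi> "deriv \<phi>" M "t + x" x] M'
        test_function_has_derivative[OF \<phi>] by simp
    then have "\<bar>(1 / t) * (\<phi> (t + x) - \<phi> x)\<bar> \<le> M"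
      using that by (simp add: abs_mult divide_le_eq)
    then show ?thesis
      using M'[of x] unfolding q_def by linarith
  qed
  have deriv_0: "deriv \<phi> x = 0" if "x \<notin> {-R..R}" for x
  proof -
    have "\<forall>\<^sub>F y in nhds x. y \<in> - {-R..R}"
      using that by (intro eventually_nhds_in_open) auto
    then have "\<forall>\<^sub>F y in nhds x. \<phi> y = 0"
      by eventually_elim (use R(2) in blast)
    then have "deriv \<phi> x = deriv (\<lambda>_. 0) x"
      by (intro deriv_cong_ev) auto
    then show ?thesis
      by simp
  qed
  have q_0: "q t x = 0" if "\<bar>t\<bar> \<le> 1" "x \<notin> {-(R+1)..R+1}" for t x
  proof -
    have "t + x \<notin> {-R..R}" "x \<notin> {-R..R}"
      using that by auto
    then have "\<phi> (t + x) = 0" "\<phi> x = 0" "deriv \<phi> x = 0"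
      using R(2) deriv_0 by blast+
    then show ?thesis
      by (simp add: q_def)
  qed
  have q_lim: "((\<lambda>t. q t x) \<longlongrightarrow> 0) (at 0)" for x
  proof -
    have "((\<lambda>t. (\<phi> (x + t) - \<phi> x) / t) \<longlongrightarrow> deriv \<phi> x) (at 0)"
      using test_function_has_derivative[OF \<phi>, of x] by (simp add: DERIV_def)
    from tendsto_diff[OF this tendsto_const[of "deriv \<phi> x"]] show ?thesis
      by (simp add: q_def[abs_def] add.commute[of x])
  qed
  have "((\<lambda>t. LINT x|lborel. (q t x)\<^sup>2) \<longlongrightarrow> 0) (at 0)"
    unfolding tendsto_at_iff_sequentially comp_def
  proof (intro allI impI)
    fix X :: "nat \<Rightarrow> real"
    assume X: "\<forall>i. X i \<in> UNIV - {0}" "X \<longlonglongrightarrow> 0"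
    \<comment> \<open>truncation to \<open>[-1, 1]\<close>, where the common support is available for every index\<close>
    define Y where "Y i = min 1 (max (-1) (X i))" for i
    have Y: "Y i \<noteq> 0" "\<bar>Y i\<bar> \<le> 1" for i
      using X(1) by (auto simp: Y_def min_def max_def)
    have Y_lim: "Y \<longlonglongrightarrow> 0"
      using tendsto_min[OF tendsto_const[of 1] tendsto_max[OF tendsto_const[of "-1"] X(2)]]
      by (simp add: Y_def[abs_def])
    have "(\<lambda>i. LINT x|lborel. (q (Y i) x)\<^sup>2) \<longlonglongrightarrow> (LINT x::real|lborel. (0::real))"
    proof (rule integral_dominated_convergence)
      show "integrable lborel (\<lambda>x. (2 * M)\<^sup>2 * indicator {-(R+1)..R+1} x)"
        by (intro integrable_mult_right integrable_real_indicator emeasure_bounded_finite) auto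
      have lim: "(\<lambda>i. q (Y i) x) \<longlonglongrightarrow> 0" for x
        using Y(1) by (intro filterlim_compose[OF q_lim]) (simp add: filterlim_at Y_lim)
      have "(\<lambda>i. (q (Y i) x)\<^sup>2) \<longlonglongrightarrow> 0" for x
        using tendsto_power[OF lim[of x], of 2] by simp
      then show "AE x in lborel. (\<lambda>i. (q (Y i) x)\<^sup>2) \<longlonglongrightarrow> 0"
        by simp
      have "norm ((q (Y i) x)\<^sup>2) \<le> (2 * M)\<^sup>2 * indicator {-(R+1)..R+1} x" for i x
        using power_mono[OF q_bound[OF Y(1), of i x] abs_ge_zero, of 2] q_0[OF Y(2), of x i]
        by (auto simp: indicator_def)
      then show "AE x in lborel. norm ((q (Y i) x)\<^sup>2) \<le> (2 * M)\<^sup>2 * indicator {-(R+1)..R+1} x" for i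
        by simp
    qed (auto simp: q_def)
    moreover have "\<forall>\<^sub>F i in sequentially. (LINT x|lborel. (q (Y i) x)\<^sup>2) = (LINT x|lborel. (q (X i) x)\<^sup>2)"
    proof -
      have "\<forall>\<^sub>F i in sequentially. dist (X i) 0 < 1"
        using X(2) by (rule tendstoD) simp
      then show ?thesis
      proof eventually_elim
        case (elim i)
        then have "Y i = X i"
          by (simp add: Y_def)
        then show ?case
          by simp
      qed
    qed
    ultimately show "(\<lambda>i. LINT x|lborel. (q (X i) x)\<^sup>2) \<longlonglongrightarrow> 0"
      by (simp add: tendsto_cong)
  qed
  from tendsto_real_sqrt[OF this] have "((\<lambda>t. norm ((1 / t) *\<^sub>R (translate t (test_class \<phi>) - test_class \<phi>)
      - test_class (deriv \<phi>))) \<longlongrightarrow> 0) (at 0)"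
    by (simp add: norm_eq)
  then show ?thesis
    by (simp add: has_vector_derivative_at_0_iff translate_0 LIM_zero_iff tendsto_norm_zero_iff)
qed

lemma translate_diff: "translate t (f - g) = translate t f - translate t g"
  using translate_plus[of t "f - g" g] by (simp add: algebra_simps)

lemma norm_translate: "norm (translate t f) = norm f"
  by (simp add: norm_eq_sqrt_inner inner_eq_Re_cinner translate_cinner)

text \<open>
  The vectors with continuous orbit form a subspace, which is closed since translations are isometric
  and which contains the test functions. These separate points, so the subspace is dense.
\<close>

lemma translate_tendsto_0: "((\<lambda>t. translate t f) \<longlongrightarrow> f) (at 0)"
proof -
  define S where "S = {f. ((\<lambda>t. translate t f) \<longlongrightarrow> f) (at 0)}"
  have "csubspace S"
    unfolding csubspace_def
  proof (intro conjI allI ballI)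
    have "translate t 0 = 0" for t
      using translate_diff[of t 0 0] by simp
    then show "0 \<in> S"
      by (simp add: S_def)
  qed (auto simp: S_def translate_plus translate_scaleC
      intro: tendsto_add bounded_linear.tendsto[OF bounded_linear_scaleC])
  moreover have "test_class \<phi> \<in> S" if "\<phi> \<in> test_functions" for \<phi>
    using has_vector_derivative_continuous[OF test_class_has_derivative[OF that]]
    by (simp add: S_def continuous_at translate_0)
  then have "u = 0" if "\<And>c. c \<in> S \<Longrightarrow> cinner c u = 0" for u
    using that by (intro test_classes_separating) (metis cinner_commute complex_cnj_zero)
  ultimately have "closure S = UNIV"
    by (rule csubspace_dense_if_separating)
  moreover have "closed S"
    unfolding closed_sequential_limits
  proof safe
    fix X f assume X: "\<forall>n. X n \<in> S" "X \<longlonglongrightarrow> f"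
    have "\<forall>\<^sub>F t in at 0. dist (translate t f) f < e" if e: "e > 0" for e
    proof -
      from X(2) e obtain n where n: "dist (X n) f < e / 3"
        by (metis divide_pos_pos lim_sequentially order_refl zero_less_numeral)
      have "\<forall>\<^sub>F t in at 0. dist (translate t (X n)) (X n) < e / 3"
        using X(1) e by (intro tendstoD) (auto simp: S_def)
      then show ?thesis
      proof eventually_elim
        case (elim t)
        have "dist (translate t f) (translate t (X n)) = dist (X n) f"
          by (simp add: dist_norm norm_translate norm_minus_commute flip: translate_diff)
        then show ?case
          using n elim dist_triangle_third[of "translate t f" "translate t (X n)" e "X n" f] by simp
      qed
    qed
    then show "f \<in> S"
      by (auto simp: S_def intro: tendstoI)
  qed
  ultimately show ?thesis
    by (auto simp: S_def closure_closed)
qed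

lemma translate_unitary_group: "unitary_group translate"
  unfolding unitary_group_def
proof (intro conjI allI)
  show "continuous_on UNIV (\<lambda>t. translate t f)" for f
  proof (intro continuous_at_imp_continuous_on ballI)
    fix s :: real
    have "((\<lambda>h. norm (translate h f - f)) \<longlongrightarrow> 0) (at 0)"
      using translate_tendsto_0 by (simp add: LIM_zero_iff tendsto_norm_zero_iff)
    moreover have "norm (translate h f - f) = norm (translate (s + h) f - translate s f)" for h
      by (simp add: translate_add_arg norm_translate flip: translate_diff)
    ultimately have "((\<lambda>h. translate (s + h) f) \<longlongrightarrow> translate s f) (at 0)"
      by (simp add: LIM_zero_iff tendsto_norm_zero_iff)
    then show "isCont (\<lambda>t. translate t f) s"
      by (simp add: isCont_iff)
  qed
qed (auto simp: translate_unitary translate_0 translate_add_arg fun_eq_iff)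

text \<open>
  The classes of test functions are a core for the group of translations, and on them the derivative of
  the orbit is \<open>d/dx\<close>. The weak derivative is by definition the weak relation of
  \<open>generator_from_core\<close>.
\<close>

lemma translate_derivative_iff_weak_deriv:
  "((\<lambda>t. translate t f) has_vector_derivative g) (at 0) \<longleftrightarrow> has_weak_deriv f g"
proof
  assume "((\<lambda>t. translate t f) has_vector_derivative g) (at 0)"
  then have "cinner g (test_class \<phi>) = - cinner f (test_class (deriv \<phi>))" if "\<phi> \<in> test_functions" for \<phi>
    by (rule generator_skew_symmetric[OF translate_unitary_group _ test_class_has_derivative[OF that]])
  then show "has_weak_deriv f g"
    by (simp add: has_weak_deriv_iff)
next
  assume weak: "has_weak_deriv f g"
  let ?C = "test_class ` test_functions"
  \<comment> \<open>any representative will do: by \<open>C\<close> below, the value of \<open>G\<close> comes from some test function in the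
    class of \<open>c\<close>\<close>
  define G where "G c = test_class (deriv (SOME \<phi>. \<phi> \<in> test_functions \<and> test_class \<phi> = c))" for c
  have C: "\<exists>\<phi>\<in>test_functions. c = test_class \<phi> \<and> G c = test_class (deriv \<phi>)" if "c \<in> ?C" for c
  proof -
    have "\<exists>\<phi>. \<phi> \<in> test_functions \<and> test_class \<phi> = c"
      using that by blast
    from someI_ex[OF this] show ?thesis
      unfolding G_def by metis
  qed
  show "((\<lambda>t. translate t f) has_vector_derivative g) (at 0)"
  proof (rule generator_from_core[OF translate_unitary_group, where C = ?C and G = G])
    fix c t assume c: "c \<in> ?C"
    then obtain \<phi> where \<phi>: "\<phi> \<in> test_functions" "c = test_class \<phi>" "G c = test_class (deriv \<phi>)"
      using C by blast
    show "((\<lambda>t. translate t c) has_vector_derivative G c) (at 0)"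
      unfolding \<phi>(3) unfolding \<phi>(2) by (rule test_class_has_derivative[OF \<phi>(1)])
    show "translate t c \<in> ?C"
      using \<phi> by (simp add: translate_test_class test_function_translate)
    have "cinner f (G c) = - cinner g c"
      using weak \<phi> by (simp add: has_weak_deriv_iff)
    then show "cinner (G c) f = - cinner c g"
      by (metis cinner_commute complex_cnj_minus)
  next
    fix u assume "\<And>c. c \<in> ?C \<Longrightarrow> cinner c u = 0"
    then show "u = 0"
      by (intro test_classes_separating) (metis cinner_commute complex_cnj_zero imageI)
  qed
qed

lemma translate_has_generator: "has_generator translate H1 weak_deriv"
  unfolding has_generator_iff[OF translate_unitary_group] translate_derivative_iff_weak_deriv
proof (intro allI)
  fix f h
  have "g = g'" if "has_weak_deriv f g" "has_weak_deriv f g'" for g g'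
    using that unfolding translate_derivative_iff_weak_deriv[symmetric]
    by (rule vector_derivative_unique_at)
  then show "has_weak_deriv f h \<longleftrightarrow> f \<in> H1 \<and> h = weak_deriv f"
    unfolding H1_def weak_deriv_def by (auto intro: the_equality[symmetric] theI2)
qed

lemma momentum_self_adjoint: "self_adjoint H1 momentum"
proof -
  have "self_adjoint H1 (\<lambda>f. (- \<i>) *\<^sub>C weak_deriv f)"
  proof (rule self_adjoint_generator[OF translate_unitary_group translate_has_generator])
    fix u assume u: "\<And>c. c \<in> H1 \<Longrightarrow> cinner c u = 0"
    show "u = 0"
    proof (rule test_classes_separating)
      fix \<phi> assume "\<phi> \<in> test_functions"
      then have "test_class \<phi> \<in> H1"
        using test_class_has_derivative unfolding translate_derivative_iff_weak_deriv
        by (auto simp: H1_def)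
      from u[OF this] show "cinner u (test_class \<phi>) = 0"
        by (metis cinner_commute complex_cnj_zero)
    qed
  qed
  then show ?thesis
    by (simp add: momentum_def[abs_def])
qed

lemma exp_i_momentum: "exp_i H1 momentum = translate"
proof (rule exp_i_eqI[OF momentum_self_adjoint translate_unitary_group])
  show "has_generator translate H1 (\<lambda>f. \<i> *\<^sub>C momentum f)"
    using translate_has_generator by (simp add: momentum_def scaleC_scaleC scaleC_1)
qed

section \<open>The time averages\<close>

lemma fn_borel_measurable [measurable]: "fn f \<in> borel_measurable borel"
  using fn_measurable[of f] by simp

lemma weight_powr_split:
  fixes x a b :: real
  shows "(1 + x\<^sup>2) powr a * (1 + x\<^sup>2) powr b = (1 + x\<^sup>2) powr (a + b)"
  by (rule powr_add[symmetric])

lemma weight_powr_half_square: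
  fixes x a :: real
  shows "((1 + x\<^sup>2) powr (a / 2))\<^sup>2 = (1 + x\<^sup>2) powr a"
  by (simp only: power2_eq_square[of "(1 + x\<^sup>2) powr (a / 2)"] weight_powr_split field_sum_of_halves)

lemma weight_nonzero [simp]: "1 + x\<^sup>2 \<noteq> (0::real)"
  by (metis add_nonneg_eq_0_iff zero_le_one zero_le_power2 zero_neq_one)

lemma weight_integrable:
  fixes \<sigma> :: real
  assumes "\<sigma> > 1 / 2"
  shows "integrable lborel (\<lambda>x. (1 + x\<^sup>2) powr (- \<sigma>))"
proof -
  define h where "h x = indicator {1..} x * x powr (- 2 * \<sigma>)" for x :: real
  have h: "integrable lborel h"
  proof (rule integrableI_nonneg)
    obtain I where "((\<lambda>x::real. x powr (- 2 * \<sigma>)) has_integral I) {1..}"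
      using has_integral_powr_to_inf[of "- 2 * \<sigma>" 1] assms by fastforce
    from nn_integral_has_integral_lebesgue[OF _ this]
    show "(\<integral>\<^sup>+x. ennreal (h x) \<partial>lborel) < \<infinity>"
      by (simp add: h_def)
  qed (auto simp: h_def[abs_def])
  have h': "integrable lborel (\<lambda>x. h (- x))"
    using lborel_integrable_real_affine[OF h, of "-1" 0] by simp
  have pow: "(1 + x\<^sup>2) powr (- \<sigma>) \<le> h x" if "x \<ge> 1" for x
  proof -
    have "(1 + x\<^sup>2) powr (- \<sigma>) \<le> (x\<^sup>2) powr (- \<sigma>)"
      using that assms by (intro powr_mono2') auto
    also have "x\<^sup>2 = x powr 2"
      using that by simp
    also have "(x powr 2) powr (- \<sigma>) = x powr (2 * - \<sigma>)"
      by (rule powr_powr)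
    also have "\<dots> = h x"
      using that by (simp add: h_def)
    finally show ?thesis
      using that by simp
  qed
  have small: "(1 + x\<^sup>2) powr (- \<sigma>) \<le> 1" for x :: real
    using powr_mono2'[of "- \<sigma>" 1 "1 + x\<^sup>2"] assms by simp
  have h0: "h x \<ge> 0" for x
    by (simp add: h_def)
  show ?thesis
  proof (rule Bochner_Integration.integrable_bound)
    show "integrable lborel (\<lambda>x. indicator {-1..1} x + h x + h (- x))"
      by (intro Bochner_Integration.integrable_add h h' integrable_real_indicator
          emeasure_bounded_finite) auto
    have "(1 + x\<^sup>2) powr (- \<sigma>) \<le> indicator {-1..1} x + h x + h (- x)" for x
    proof -
      consider "x \<ge> 1" | "- x \<ge> 1" | "x \<in> {-1..1}"
        by fastforce
      then show ?thesis
        using pow[of x] pow[of "- x"] small[of x] h0[of x] h0[of "- x"]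
        by cases (auto intro: order_trans simp: add_increasing add_increasing2)
    qed
    then show "AE x in lborel. norm ((1 + x\<^sup>2) powr (- \<sigma>)) \<le> norm (indicator {-1..1} x + h x + h (- x))"
      using h0 by (intro AE_I2) (simp add: add_nonneg_nonneg)
  qed measurable
qed

text \<open>
  The Cauchy-Schwarz inequality in \<open>L\<^sup>2\<close> for the factorisation
  \<open>|f| = (1 + x\<^sup>2)\<^bsup>-\<sigma>/2\<^esup> \<cdot> (1 + x\<^sup>2)\<^bsup>\<sigma>/2\<^esup> |f|\<close>.
\<close>

lemma L2w_integrable_bound:
  assumes \<sigma>: "\<sigma> > 1 / 2" and f: "f \<in> L2w \<sigma>"
  shows "integrable lborel (\<lambda>x. cmod (rep_L0 f x))"
    and "(LINT x|lborel. cmod (rep_L0 f x))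
      \<le> sqrt (LINT x|lborel. (1 + x\<^sup>2) powr (- \<sigma>)) * wnorm \<sigma> f"
proof -
  have [measurable]: "rep_L0 f \<in> borel_measurable borel"
    using rep_L0_measurable[of f] by simp
  define a where "a = to_L2 (\<lambda>x. complex_of_real ((1 + x\<^sup>2) powr (- \<sigma> / 2)))"
  define b where "b = to_L2 (\<lambda>x. complex_of_real ((1 + x\<^sup>2) powr (\<sigma> / 2) * cmod (rep_L0 f x)))"
  have a_sq: "(cmod (complex_of_real ((1 + x\<^sup>2) powr (- \<sigma> / 2))))\<^sup>2 = (1 + x\<^sup>2) powr (- \<sigma>)" for x :: real
    using weight_powr_half_square[of x "- \<sigma>"] by simp
  have b_sq: "(cmod (complex_of_real ((1 + x\<^sup>2) powr (\<sigma> / 2) * cmod (rep_L0 f x))))\<^sup>2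
      = (1 + x\<^sup>2) powr \<sigma> * (cmod (rep_L0 f x))\<^sup>2" for x
    using weight_powr_half_square[of x \<sigma>] by (simp add: norm_mult power_mult_distrib)
  have fn_a: "AE x in lborel. fn a x = complex_of_real ((1 + x\<^sup>2) powr (- \<sigma> / 2))"
    unfolding a_def
    by (rule fn_to_L2) (measurable, unfold a_sq, rule weight_integrable[OF \<sigma>])
  have fn_b: "AE x in lborel. fn b x = complex_of_real ((1 + x\<^sup>2) powr (\<sigma> / 2) * cmod (rep_L0 f x))"
    unfolding b_def
    by (rule fn_to_L2) (measurable, unfold b_sq, use f in \<open>simp add: L2w_def\<close>)
  have norm_a: "norm a = sqrt (LINT x|lborel. (1 + x\<^sup>2) powr (- \<sigma>))"
    unfolding norm_L2_eq
    by (subst integral_cong_AE[where g = "\<lambda>x. (1 + x\<^sup>2) powr (- \<sigma>)"])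
       (use fn_a in \<open>auto elim!: eventually_mono simp flip: a_sq\<close>)
  have norm_b: "norm b = wnorm \<sigma> f"
    unfolding norm_L2_eq wnorm_def
    by (subst integral_cong_AE[where g = "\<lambda>x. (1 + x\<^sup>2) powr \<sigma> * (cmod (rep_L0 f x))\<^sup>2"])
       (use fn_b in \<open>auto elim!: eventually_mono simp flip: b_sq\<close>)
  have prod: "AE x in lborel. fn a x * cnj (fn b x) = complex_of_real (cmod (rep_L0 f x))"
    using fn_a fn_b
  proof eventually_elim
    case (elim x)
    have "(1 + x\<^sup>2) powr (- \<sigma> / 2) * ((1 + x\<^sup>2) powr (\<sigma> / 2) * cmod (rep_L0 f x)) = cmod (rep_L0 f x)"
      by (simp add: weight_powr_split flip: mult.assoc)
    then show ?case
      unfolding elim by (simp flip: of_real_mult)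
  qed
  have "integrable lborel (\<lambda>x. complex_of_real (cmod (rep_L0 f x)))"
    by (rule integrable_cong_AE_imp[OF fn_product_integrable[of a b]])
       (use prod in \<open>auto elim!: eventually_mono\<close>)
  then show "integrable lborel (\<lambda>x. cmod (rep_L0 f x))"
    using integrable_Re by fastforce
  have "cinner a b = complex_of_real (LINT x|lborel. cmod (rep_L0 f x))"
    unfolding cinner_L2_def integral_complex_of_real[symmetric]
    by (rule integral_cong_AE) (use prod in auto)
  then have "inner a b = (LINT x|lborel. cmod (rep_L0 f x))"
    by (simp add: inner_eq_Re_cinner)
  then show "(LINT x|lborel. cmod (rep_L0 f x))
      \<le> sqrt (LINT x|lborel. (1 + x\<^sup>2) powr (- \<sigma>)) * wnorm \<sigma> f"
    using Cauchy_Schwarz_ineq2[of a b] by (simp add: norm_a norm_b)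
qed

text \<open>
  Taking absolute values under the integrals and extending the range of \<open>t\<close> to the whole line leaves, by
  Tonelli's theorem and translation invariance, a product of two integrals. The bound does not depend
  on \<open>T\<close>, which is what makes the averages decay.
\<close>

lemma cinner_integral_translate_bound:
  assumes f: "integrable lborel (\<lambda>x. cmod (fn f x))" and g: "integrable lborel (\<lambda>x. cmod (fn g x))"
  shows "cmod (cinner (integral {-T..T} (\<lambda>t. translate t f)) g)
    \<le> (LINT x|lborel. cmod (fn f x)) * (LINT x|lborel. cmod (fn g x))"
proof -
  define p where "p t = cmod (cinner (translate t f) g)" for t
  have int: "(\<lambda>t. translate t f) integrable_on {-T..T}"
    by (intro integrable_continuous_real unitary_group_continuous translate_unitary_group)
  have cont: "continuous_on {-T..T} (\<lambda>t. cinner (translate t f) g)"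
    by (intro bounded_linear.continuous_on[OF bounded_linear_cinner_left]
        unitary_group_continuous translate_unitary_group)
  have p_int: "p integrable_on {-T..T}"
    unfolding p_def by (intro integrable_continuous_real continuous_on_norm cont)
  have p_le: "ennreal (p t) \<le> (\<integral>\<^sup>+x. ennreal (cmod (fn f (t + x))) * ennreal (cmod (fn g x)) \<partial>lborel)" for t
  proof -
    have "ennreal (p t) \<le> (\<integral>\<^sup>+x. ennreal (norm (fn (translate t f) x * cnj (fn g x))) \<partial>lborel)"
      unfolding p_def cinner_L2_def by (intro integral_norm_bound_ennreal fn_product_integrable)
    also have "\<dots> = (\<integral>\<^sup>+x. ennreal (cmod (fn f (t + x))) * ennreal (cmod (fn g x)) \<partial>lborel)"
    proof (rule nn_integral_cong_AE)
      show "AE x in lborel. ennreal (norm (fn (translate t f) x * cnj (fn g x))) =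
          ennreal (cmod (fn f (t + x))) * ennreal (cmod (fn g x))"
        using fn_translate[of t f] by eventually_elim (simp add: norm_mult ennreal_mult)
    qed
    finally show ?thesis .
  qed
  have "ennreal (integral {-T..T} p) = (\<integral>\<^sup>+t. ennreal (indicator {-T..T} t * p t) \<partial>lborel)"
    by (rule nn_integral_has_integral_lebesgue[symmetric, OF _ integrable_integral[OF p_int]])
       (simp add: p_def)
  also have "\<dots> \<le> (\<integral>\<^sup>+t. (\<integral>\<^sup>+x. ennreal (cmod (fn f (t + x))) * ennreal (cmod (fn g x)) \<partial>lborel) \<partial>lborel)"
    using p_le by (intro nn_integral_mono) (auto simp: indicator_def)
  also have "\<dots> = (\<integral>\<^sup>+x. (\<integral>\<^sup>+t. ennreal (cmod (fn f (t + x))) * ennreal (cmod (fn g x)) \<partial>lborel) \<partial>lborel)"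
    by (rule lborel_pair.Fubini'[symmetric]) measurable
  also have "\<dots> = (\<integral>\<^sup>+x. (\<integral>\<^sup>+t. ennreal (cmod (fn f t)) \<partial>lborel) * ennreal (cmod (fn g x)) \<partial>lborel)"
    using nn_integral_real_affine[of "\<lambda>t. ennreal (cmod (fn f t))" 1]
    by (intro nn_integral_cong) (simp add: nn_integral_multc add.commute)
  also have "\<dots> = (\<integral>\<^sup>+t. ennreal (cmod (fn f t)) \<partial>lborel) * (\<integral>\<^sup>+x. ennreal (cmod (fn g x)) \<partial>lborel)"
    by (rule nn_integral_cmult) measurable
  also have "\<dots> = ennreal ((LINT x|lborel. cmod (fn f x)) * (LINT x|lborel. cmod (fn g x)))"
    by (simp add: nn_integral_eq_integral f g ennreal_mult)
  finally have "integral {-T..T} p \<le> (LINT x|lborel. cmod (fn f x)) * (LINT x|lborel. cmod (fn g x))"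
    by (subst (asm) ennreal_le_iff) simp_all
  moreover have "cinner (integral {-T..T} (\<lambda>t. translate t f)) g
      = integral {-T..T} (\<lambda>t. cinner (translate t f) g)"
    using integral_linear[OF int bounded_linear_cinner_left[of g]] by (simp add: comp_def)
  moreover have "cmod (integral {-T..T} (\<lambda>t. cinner (translate t f) g)) \<le> integral {-T..T} p"
    unfolding p_def
    by (intro Henstock_Kurzweil_Integration.integral_norm_bound_integral integrable_continuous_real
        cont continuous_on_norm) simp
  ultimately show ?thesis
    by simp
qed

lemma wnorm_nonneg: "wnorm s f \<ge> 0"
  by (simp add: wnorm_def)

lemma wnorm_square: "(wnorm s f)\<^sup>2 = (LINT x|lborel. (1 + x\<^sup>2) powr s * (cmod (rep_L0 f x))\<^sup>2)"
  by (simp add: wnorm_def)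

text \<open>
  The extremal \<open>g\<close> is \<open>(1 + x\<^sup>2)\<^sup>-\<^sup>\<sigma> u\<close>: its norm in \<open>L\<^sup>2\<^sup>,\<^sup>\<sigma>\<close> is the norm of \<open>u\<close> in \<open>L\<^sup>2\<^sup>,\<^sup>-\<^sup>\<sigma>\<close>, and its
  pairing with \<open>u\<close> is the square of that norm.
\<close>

lemma wnorm_le_by_duality:
  assumes \<sigma>: "\<sigma> \<ge> 0" and C: "C \<ge> 0"
    and bound: "\<And>g. Rep_L2 g \<in> L2w \<sigma> \<Longrightarrow> cmod (cinner u g) \<le> C * wnorm \<sigma> (Rep_L2 g)"
  shows "wnorm (- \<sigma>) (Rep_L2 u) \<le> C"
proof -
  define k where "k x = complex_of_real ((1 + x\<^sup>2) powr (- \<sigma>)) * fn u x" for x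
  have [measurable]: "k \<in> borel_measurable borel"
    unfolding k_def by measurable
  have small: "(1 + x\<^sup>2) powr (- \<sigma>) \<le> 1" for x :: real
    using powr_mono2'[of "- \<sigma>" 1 "1 + x\<^sup>2"] \<sigma> by simp
  have k_le: "cmod (k x) \<le> cmod (fn u x)" for x
    using small[of x] by (simp add: k_def norm_mult mult_left_le_one_le)
  define g where "g = to_L2 k"
  have fn_g: "AE x in lborel. fn g x = k x"
    unfolding g_def
  proof (rule fn_to_L2)
    show "integrable lborel (\<lambda>x. (cmod (k x))\<^sup>2)"
      by (rule Bochner_Integration.integrable_bound[OF fn_square_integrable[of u]])
         (auto intro!: power_mono k_le)
  qed simp
  have weight: "(1 + x\<^sup>2) powr \<sigma> * (cmod (k x))\<^sup>2 = (1 + x\<^sup>2) powr (- \<sigma>) * (cmod (fn u x))\<^sup>2" for x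
  proof -
    have "(1 + x\<^sup>2) powr \<sigma> * (cmod (k x))\<^sup>2
        = ((1 + x\<^sup>2) powr \<sigma> * (1 + x\<^sup>2) powr (- \<sigma>)) * (1 + x\<^sup>2) powr (- \<sigma>) * (cmod (fn u x))\<^sup>2"
      by (simp add: k_def norm_mult power_mult_distrib power2_eq_square mult_ac)
    then show ?thesis
      by (simp add: weight_powr_split)
  qed
  have fn_g_weight: "AE x in lborel. (1 + x\<^sup>2) powr \<sigma> * (cmod (fn g x))\<^sup>2
      = (1 + x\<^sup>2) powr (- \<sigma>) * (cmod (fn u x))\<^sup>2"
    using fn_g by eventually_elim (simp add: weight)
  have "Rep_L2 u \<in> L2w (- \<sigma>)"
    using L2w_mono[of "- \<sigma>" 0] \<sigma> Rep_L2[of u] by auto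
  then have int: "integrable lborel (\<lambda>x. (1 + x\<^sup>2) powr (- \<sigma>) * (cmod (fn u x))\<^sup>2)"
    by (simp add: L2w_def)
  then have gL: "Rep_L2 g \<in> L2w \<sigma>"
    using integrable_cong_AE[OF _ _ fn_g_weight] by (simp add: L2w_def)
  have "wnorm \<sigma> (Rep_L2 g) = wnorm (- \<sigma>) (Rep_L2 u)"
    unfolding wnorm_def using integral_cong_AE[OF _ _ fn_g_weight] by simp
  moreover have "cinner u g = complex_of_real ((wnorm (- \<sigma>) (Rep_L2 u))\<^sup>2)"
    unfolding cinner_L2_def wnorm_square integral_complex_of_real[symmetric]
  proof (rule integral_cong_AE)
    show "AE x in lborel. fn u x * cnj (fn g x)
        = complex_of_real ((1 + x\<^sup>2) powr (- \<sigma>) * (cmod (fn u x))\<^sup>2)"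
      using fn_g by eventually_elim (simp add: k_def mult_ac, metis complex_norm_square of_real_power)
  qed measurable
  ultimately have "(wnorm (- \<sigma>) (Rep_L2 u))\<^sup>2 \<le> C * wnorm (- \<sigma>) (Rep_L2 u)"
    using bound[OF gL] by (simp add: norm_power)
  then show ?thesis
    using C wnorm_nonneg[of "- \<sigma>" "Rep_L2 u"]
    by (cases "wnorm (- \<sigma>) (Rep_L2 u) = 0") (auto simp: power2_eq_square)
qed

lemma time_average_momentum_bound:
  assumes \<sigma>: "\<sigma> > 1 / 2" and T: "T > 0" and f: "f \<in> L2w \<sigma>"
  shows "wnorm (- \<sigma>) (via_L2 (time_average H1 momentum T) f)
    \<le> (LINT x|lborel. (1 + x\<^sup>2) powr (- \<sigma>)) / (2 * T) * wnorm \<sigma> f"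
proof -
  define K where "K = (LINT x::real|lborel. (1 + x\<^sup>2) powr (- \<sigma>))"
  have K: "K \<ge> 0"
    by (simp add: K_def)
  define F where "F = Abs_L2 f"
  have "f \<in> L2w 0"
    using L2w_mono[of 0 \<sigma>] \<sigma> f by auto
  then have Rep_F: "Rep_L2 F = f"
    by (simp add: F_def Abs_L2_inverse)
  have "wnorm (- \<sigma>) (Rep_L2 (time_average H1 momentum T F)) \<le> K / (2 * T) * wnorm \<sigma> f"
  proof (rule wnorm_le_by_duality)
    fix g assume g: "Rep_L2 g \<in> L2w \<sigma>"
    let ?I = "integral {-T..T} (\<lambda>t. translate t F)"
    have "cmod (cinner ?I g) \<le> (LINT x|lborel. cmod (fn F x)) * (LINT x|lborel. cmod (fn g x))"
      using L2w_integrable_bound(1)[OF \<sigma> f] L2w_integrable_bound(1)[OF \<sigma> g]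
      by (intro cinner_integral_translate_bound) (simp_all add: Rep_F)
    also have "\<dots> \<le> (sqrt K * wnorm \<sigma> f) * (sqrt K * wnorm \<sigma> (Rep_L2 g))"
      using L2w_integrable_bound(2)[OF \<sigma> f] L2w_integrable_bound(2)[OF \<sigma> g] K
      by (intro mult_mono) (simp_all add: Rep_F K_def wnorm_nonneg)
    also have "\<dots> = K * wnorm \<sigma> f * wnorm \<sigma> (Rep_L2 g)"
      using K by simp
    finally have I: "cmod (cinner ?I g) \<le> K * wnorm \<sigma> f * wnorm \<sigma> (Rep_L2 g)" .
    have "cinner (time_average H1 momentum T F) g = complex_of_real (1 / (2 * T)) * cinner ?I g"
      by (simp add: time_average_def exp_i_momentum scaleR_scaleC cinner_scaleC_left)
    then have "cmod (cinner (time_average H1 momentum T F) g) = cmod (cinner ?I g) / (2 * T)"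
      using T by (simp add: norm_mult norm_divide)
    also have "\<dots> \<le> K * wnorm \<sigma> f * wnorm \<sigma> (Rep_L2 g) / (2 * T)"
      using T by (intro divide_right_mono I) simp
    finally show "cmod (cinner (time_average H1 momentum T F) g)
        \<le> K / (2 * T) * wnorm \<sigma> f * wnorm \<sigma> (Rep_L2 g)"
      by simp
  qed (use \<sigma> T K in \<open>simp_all add: wnorm_nonneg\<close>)
  then show ?thesis
    by (simp add: via_L2_def F_def K_def)
qed

lemma time_average_momentum_linear:
  "clinear_on UNIV (time_average H1 momentum T)"
proof -
  have int: "(\<lambda>t. translate t f) integrable_on {-T..T}" for f
    by (intro integrable_continuous_real unitary_group_continuous translate_unitary_group)
  have "integral {-T..T} (\<lambda>t. translate t (f + g))
      = integral {-T..T} (\<lambda>t. translate t f) + integral {-T..T} (\<lambda>t. translate t g)" for f g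
    by (simp add: translate_plus Henstock_Kurzweil_Integration.integral_add int)
  moreover have "integral {-T..T} (\<lambda>t. translate t (c *\<^sub>C f)) = c *\<^sub>C integral {-T..T} (\<lambda>t. translate t f)"
    for c f
    using integral_linear[OF int bounded_linear_scaleC[of c], of f] by (simp add: comp_def translate_scaleC)
  ultimately show ?thesis
    by (simp add: clinear_on_def time_average_def exp_i_momentum scaleR_scaleC scaleC_add_right
        scaleC_scaleC mult.commute)
qed

lemma time_average_momentum_bounded:
  assumes \<sigma>: "\<sigma> > 1 / 2" and T: "T > 0"
  shows "via_L2 (time_average H1 momentum T) \<in> bounded_ops \<sigma> (- \<sigma>)"
proof -
  have sub: "L2w \<sigma> \<subseteq> L2w 0" "L2w 0 \<subseteq> L2w (- \<sigma>)"
    using \<sigma> by (simp_all add: L2w_mono)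
  have add: "Abs_L2 (f + g) = Abs_L2 f + Abs_L2 g" if "f \<in> L2w \<sigma>" "g \<in> L2w \<sigma>" for f g
    using that sub(1) by (intro Rep_L2_inject[THEN iffD1])
      (auto simp: plus_L2.rep_eq Abs_L2_inverse add_in_L2w_zero subset_iff)
  have scale: "Abs_L2 (c *\<^sub>C f) = c *\<^sub>C Abs_L2 f" if "f \<in> L2w \<sigma>" for c f
    using that sub(1) by (intro Rep_L2_inject[THEN iffD1])
      (auto simp: scaleC_L2.rep_eq Abs_L2_inverse scaleC_in_L2w_zero subset_iff)
  have "clinear_on (L2w \<sigma>) (via_L2 (time_average H1 momentum T))"
    using time_average_momentum_linear[of T] unfolding clinear_on_def via_L2_def
    by (simp add: add scale plus_L2.rep_eq scaleC_L2.rep_eq)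
  moreover have "via_L2 (time_average H1 momentum T) f \<in> L2w (- \<sigma>)" for f
    using sub(2) Rep_L2 by (auto simp: via_L2_def)
  ultimately show ?thesis
    using time_average_momentum_bound[OF \<sigma> T] unfolding bounded_ops_def by blast
qed

lemma wnorm_zero: "wnorm s 0 = 0"
proof -
  have "(LINT x|lborel. (1 + x\<^sup>2) powr s * (cmod (rep_L0 0 x))\<^sup>2) = (LINT x::real|lborel. 0)"
    using rep_zero_L0 rep_L0_measurable[of 0]
    by (intro integral_cong_AE) (auto elim!: eventually_mono)
  then show ?thesis
    by (simp add: wnorm_def)
qed

text \<open>
  A real supremum is meaningful only for a nonempty bounded set. Here the set contains the norm of the
  image of \<open>0\<close>, whence the lower bound, and is bounded by \<open>C\<close>.
\<close>

lemma op_norm_le: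
  assumes "\<And>f. f \<in> L2w s \<Longrightarrow> wnorm s' (B f) \<le> C * wnorm s f" and "C \<ge> 0"
  shows "0 \<le> op_norm s s' B" and "op_norm s s' B \<le> C"
proof -
  let ?N = "{wnorm s' (B f) |f. f \<in> L2w s \<and> wnorm s f \<le> 1}"
  have zero: "wnorm s' (B 0) \<in> ?N"
    using zero_in_L2w[of s] wnorm_zero[of s] by auto
  have le: "y \<le> C" if "y \<in> ?N" for y
  proof -
    from that obtain f where f: "y = wnorm s' (B f)" "f \<in> L2w s" "wnorm s f \<le> 1"
      by auto
    then show ?thesis
      using assms(1)[OF f(2)] mult_left_mono[OF f(3) assms(2)] by simp
  qed
  have "wnorm s' (B 0) \<le> Sup ?N"
    using zero le by (intro cSup_upper) (auto simp: bdd_above_def)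
  then show "0 \<le> op_norm s s' B"
    using wnorm_nonneg[of s' "B 0"] by (simp add: op_norm_def)
  show "op_norm s s' B \<le> C"
    unfolding op_norm_def using zero le by (intro cSup_least) auto
qed

theorem theorem1p3:
  fixes \<sigma> :: real
  assumes "\<sigma> > 1 / 2"
  shows "self_adjoint H1 momentum \<and>
    (\<forall>T>0. via_L2 (time_average H1 momentum T) \<in> bounded_ops \<sigma> (- \<sigma>)) \<and>
    uniform_op_tendsto \<sigma> (- \<sigma>) (\<lambda>T. via_L2 (time_average H1 momentum T)) (\<lambda>_. 0) at_top"
proof (intro conjI allI impI)
  show "self_adjoint H1 momentum"
    by (rule momentum_self_adjoint)
  show bounded: "via_L2 (time_average H1 momentum T) \<in> bounded_ops \<sigma> (- \<sigma>)" if "T > 0" for T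
    by (rule time_average_momentum_bounded[OF assms that])
  define K where "K = (LINT x::real|lborel. (1 + x\<^sup>2) powr (- \<sigma>))"
  have K: "K \<ge> 0"
    by (simp add: K_def)
  have zero: "(\<lambda>_. 0) \<in> bounded_ops \<sigma> (- \<sigma>)"
    by (auto simp: bounded_ops_def clinear_on_def zero_in_L2w wnorm_zero scaleC_0 intro!: exI[of _ 0])
  have norm: "0 \<le> op_norm \<sigma> (- \<sigma>) (\<lambda>f. via_L2 (time_average H1 momentum T) f - 0) \<and>
      op_norm \<sigma> (- \<sigma>) (\<lambda>f. via_L2 (time_average H1 momentum T) f - 0) \<le> K / (2 * T)" if T: "T > 0" for T
  proof -
    have "wnorm (- \<sigma>) (via_L2 (time_average H1 momentum T) f - 0) \<le> K / (2 * T) * wnorm \<sigma> f"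
      if "f \<in> L2w \<sigma>" for f
      using time_average_momentum_bound[OF assms T that] by (simp add: K_def)
    moreover have "K / (2 * T) \<ge> 0"
      using K T by simp
    ultimately show ?thesis
      by (intro conjI op_norm_le)
  qed
  have "((\<lambda>T. op_norm \<sigma> (- \<sigma>) (\<lambda>f. via_L2 (time_average H1 momentum T) f - 0)) \<longlongrightarrow> 0) at_top"
  proof (rule tendsto_sandwich[where f = "\<lambda>_. 0"])
    have "((\<lambda>T. (K / 2) * inverse T) \<longlongrightarrow> (K / 2) * 0) at_top"
      by (intro tendsto_intros tendsto_inverse_0_at_top filterlim_ident)
    then show "((\<lambda>T. K / (2 * T)) \<longlongrightarrow> 0) at_top"
      by (simp add: field_simps)
    have pos: "\<forall>\<^sub>F T :: real in at_top. T > 0"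
      by (rule eventually_gt_at_top)
    show "\<forall>\<^sub>F T in at_top. 0 \<le> op_norm \<sigma> (- \<sigma>) (\<lambda>f. via_L2 (time_average H1 momentum T) f - 0)"
      using pos by eventually_elim (use norm in blast)
    show "\<forall>\<^sub>F T in at_top.
        op_norm \<sigma> (- \<sigma>) (\<lambda>f. via_L2 (time_average H1 momentum T) f - 0) \<le> K / (2 * T)"
      using pos by eventually_elim (use norm in blast)
  qed simp
  then show "uniform_op_tendsto \<sigma> (- \<sigma>) (\<lambda>T. via_L2 (time_average H1 momentum T)) (\<lambda>_. 0) at_top"
    unfolding uniform_op_tendsto_def
    using zero bounded eventually_mono[OF eventually_gt_at_top[of "0::real"]] by simp
qed

end
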